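(* Assume A1 and A2, with all objects as defined in the context. The approximation $\widehat{\mathrm S}_D(\theta)$ of the power spectral density of the stationary sequence $\{D_{t+1}=\Delta_{t+1}+B_t^{T}\zeta_t+V_t^{T}\zeta_t^2\}$ can be expressed as the sum $$\widehat{\mathrm S}_D(\theta)=\widehat{\mathrm S}_\Delta(\theta)+\widehat{\mathrm S}_{B\zeta}(\theta)+e^{-\mathrm j\theta}\widehat{\mathrm S}_{B\zeta,\Delta}(\theta)+\bigl[e^{-\mathrm j\theta}\widehat{\mathrm S}_{B\zeta,\Delta}(\theta)\bigr]^*+e^{-\mathrm j\theta}\widehat{\mathrm S}_{V\zeta^2,\Delta}(\theta)+\bigl[e^{-\mathrm j\theta}\widehat{\mathrm S}_{V\zeta^2,\Delta}(\theta)\bigr]^*,$$ in which each approximation on the right-hand side is obtained through the Fourier transform of the corresponding approximation $\widehat R_\Delta,\widehat R_{B\zeta},\widehat R_{B\zeta,\Delta},\widehat R_{V\zeta^2,\Delta}$, and where ${}^*$ denotes complex-conjugate transpose. The power spectral density approximation for $\Gamma$ is given by $$\widehat{\mathrm S}_\Gamma(\theta)=[Ie^{-\mathrm j\theta}-\widetilde A]^{-1}\,\widehat{\mathrm S}_D(\theta)\,[Ie^{\mathrm j\theta}-\widetilde A^{T}]^{-1},$$ and the cross-power spectral density approximations are $$\widehat{\mathrm S}_{\Gamma,D}(\theta)=[Ie^{-\mathrm j\theta}-\widetilde A]^{-1}\,\widehat{\mathrm S}_D(\theta),\qquad \widehat{\mathrm S}_{\Gamma,\zeta}(\theta)=\varepsilon^2\sum_{t=-\infty}^\infty\sum_{i=1}^\infty\widetilde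 A^{\,i-1}B\,R_{\zeta^1}(t-i)e^{-\mathrm j\theta t}.$$
   Context: Setting. For each $\zeta\in\mathbb R$, $P_\zeta$ is a $d\times d$ transition (row-stochastic) matrix. A1: $P_0$ is irreducible and aperiodic; $\zeta\mapsto P_\zeta$ is twice continuously differentiable in a neighborhood of $\zeta=0$, with Lipschitz continuous second derivative. A2: $\zeta_t=\varepsilon\zeta^1_t$, where $\zeta^1=\{\zeta^1_t:t\in\mathbb Z\}$ is a real-valued stationary process with zero mean, $|\zeta^1_t|\le 1$ for all $t$ almost surely, and $\sum_{t\ge 0}|R_{\zeta^1}(t)|<\infty$, where $R_{\zeta^1}(t)=\mathsf E[\zeta^1_t\zeta^1_0]$. Here $\varepsilon\in(0,\varepsilon_0]$, where $\varepsilon_0>0$ is such that a stationary version of the controlled process below exists for each such $\varepsilon$. $\pi_0$ is the invariant probability (row) vector of $P_0$, $\Pi_0=\mathrm{diag}(\pi_0)$; $\mathcal E=\frac{d}{d\zeta}P_\zeta|_{\zeta=0}$, $\mathcal W=\frac{d^2}{d\zeta^2}P_\zeta|_{\zeta=0}$; $B^{T}=\pi_0\mathcal E$; $R_\zeta(t)=\mathsf E[\zeta_t\zeta_0]=\varepsilon^2R_{\zeta^1}(t)$; $\mathbf 1\otimes\pi_0$ is the matrix with all rows $\pi_0$; $U_1=[I-P_0+\mathbf 1\otimes\pi_0]^{-1}$; $A=P_0^{T}$; $\widetilde A=(P_0-\mathbf 1\otimes\pi_0)^{T}$; $\mathrm j=\sqrt{-1}$ in exponents. Controlled process: $\Gamma_t$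 is the stationary indicator (row-vector) process, with values in the standard basis of $\mathbb R^d$, of a process on $\{1,\dots,d\}$ whose conditional transition law given the past of the process and of $\zeta$ is $P_{\zeta_t}$. It satisfies $\Gamma_{t+1}=\Gamma_tP_{\zeta_t}+\Delta_{t+1}$ with $\Delta$ a martingale difference sequence, and $B_t^{T}=\Gamma_t\mathcal E$, $V_t^{T}=\frac12\Gamma_t\mathcal W$. The hatted quantities are second-order (in $\varepsilon$) approximations of correlations of these processes, obtained by dropping $O(\varepsilon^3)$ errors, as follows. $\widehat R_{\Gamma,\zeta}(t)=\sum_{i=1}^\infty(B^{T}P_0^{i-1})^{T}R_\zeta(t-i)$; $\hat\xi=\widehat R_{\Gamma,\zeta}(0)^{T}\mathcal E+\frac12R_\zeta(0)\pi_0\mathcal W$; $\hat\pi_\varepsilon=\pi_0+\hat\xi U_1$; $\widehat\Pi_\varepsilon=\mathrm{diag}(\hat\pi_\varepsilon)$; $\Sigma^{\Delta^\bullet}=\Pi_0-P_0^{T}\Pi_0P_0$. For $t\ge0$: $\widehat R_{\Delta^2,\zeta}(-t)=\mathrm{diag}(\widehat R_{\Gamma,\zeta}(-t-1)^{T}P_0)-P_0^{T}\mathrm{diag}(\widehat R_{\Gamma,\zeta}(-t-1))P_0+R_\zeta(t+1)\{\mathrm{diag}(\pi_0\mathcal E)-(P_0^{T}\Pi_0\mathcal E+[P_0^{T}\Pi_0\mathcal E]^{T})\}$. $\widehat R_{B\zeta}(t)=(P_0^t\mathcal E)^{T}\Pi_0\mathcal E R_\zeta(t)$ for $t\ge0$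 and $\widehat R_{B\zeta}(t)=\widehat R_{B\zeta}(-t)^{T}$ for $t<0$. $\widehat R_\Delta(t)=0$ for $t\neq0$ and $\widehat R_\Delta(0)=\widehat\Pi_\varepsilon-P_0^{T}\widehat\Pi_\varepsilon P_0-[P_0^{T}\mathrm{diag}(\widehat R_{\Gamma,\zeta}(0))\mathcal E+\mathcal E^{T}\mathrm{diag}(\widehat R_{\Gamma,\zeta}(0))P_0]-\frac12R_\zeta(0)[P_0^{T}\Pi_0\mathcal W+2\mathcal E^{T}\Pi_0\mathcal E+\mathcal W^{T}\Pi_0P_0]$. $\widehat R_{B\zeta,\Delta}(t)=0$ for $t<0$, $=\mathcal E^{T}\widehat R_{\Delta^2,\zeta}(0)$ for $t=0$, $=\mathcal E^{T}A^t\widehat R_{\Delta^2,\zeta}(-t)+\mathcal E^{T}\sum_{i=0}^{t-1}A^{t-1-i}\mathcal E^{T}A^iR_\zeta(t-i)\Sigma^{\Delta^\bullet}$ for $t\ge1$. $\widehat R_{V\zeta^2,\Delta}(t)=0$ for $t<0$, $=\frac12R_\zeta(0)(P_0^t\mathcal W)^{T}\Sigma^{\Delta^\bullet}$ for $t\ge0$. $\widehat R_D(t)=\widehat R_{B\zeta}(t)+\widehat R_\Delta(t)+\widehat R_{B\zeta,\Delta}(t-1)+\widehat R_{B\zeta,\Delta}(-t-1)^{T}+\widehat R_{V\zeta^2,\Delta}(t-1)+\widehat R_{V\zeta^2,\Delta}(-t-1)^{T}$. For each index $\ast$ among $D$, $\Delta$, $B\zeta$, $(B\zeta,\Delta)$,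 $(V\zeta^2,\Delta)$, $\widehat{\mathrm S}_\ast(\theta)=\sum_{t\in\mathbb Z}\widehat R_\ast(t)e^{-\mathrm j\theta t}$. The spectra $\widehat{\mathrm S}_\Gamma,\widehat{\mathrm S}_{\Gamma,D},\widehat{\mathrm S}_{\Gamma,\zeta}$ are the corresponding blocks of the Fourier transform $\sum_t(\cdot)e^{-\mathrm j\theta t}$ of the approximate auto-covariance of $(\Gamma,D,\zeta)$, whose blocks are, respectively, $\widehat\Sigma_\Gamma(t)=\sum_{i,k=0}^\infty\widetilde A^i\widehat R_D(t-i+k)(\widetilde A^k)^{T}$, $\widehat\Sigma_{\Gamma,D}(t)=\sum_{i=0}^\infty\widetilde A^i\widehat R_D(t-i)$, $\widehat\Sigma_{\Gamma,\zeta}(t)=\varepsilon^2\sum_{i=1}^\infty\widetilde A^{\,i-1}BR_{\zeta^1}(t-i)$.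
   Formalization: The printed factors [Ie^{-jθ}−Ã]^{-1} and [Ie^{jθ}−Ã^T]^{-1} in the formulas for S_Γ and S_{Γ,D} are wrong for the given covariances and are replaced by [I−e^{-jθ}Ã]^{-1} and [I−e^{jθ}Ã^T]^{-1}. *)

theory Defs
  imports "HOL-Probability.Probability"
begin

section \<open>Matrices\<close>

text \<open>Row and column vectors both have type \<open>real ^ 'd\<close>: a row vector acts by \<open>x v* A\<close>, a
  column vector by \<open>A *v x\<close>.  The class operations \<open>*\<close> and \<open>^\<close> on \<open>real ^ 'd ^ 'd\<close> are
  componentwise, hence the separate matrix power.\<close>

primrec mpow :: "'a::semiring_1 ^ 'd ^ 'd \<Rightarrow> nat \<Rightarrow> 'a ^ 'd ^ 'd" where
  "mpow A 0 = mat 1"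
| "mpow A (Suc n) = A ** mpow A n"

definition diag :: "real ^ 'd \<Rightarrow> real ^ 'd ^ 'd" where
  "diag v = (\<chi> i j. if i = j then v $ i else 0)"

definition mscale :: "complex \<Rightarrow> complex ^ 'n ^ 'm \<Rightarrow> complex ^ 'n ^ 'm"  (infixr "*\<^sub>C" 75) where
  "c *\<^sub>C A = (\<chi> i j. c * A $ i $ j)"

definition cvec :: "real ^ 'n \<Rightarrow> complex ^ 'n" where
  "cvec v = (\<chi> i. complex_of_real (v $ i))"

definition cmat :: "real ^ 'n ^ 'm \<Rightarrow> complex ^ 'n ^ 'm" where
  "cmat A = (\<chi> i j. complex_of_real (A $ i $ j))"

definition conj_transpose :: "complex ^ 'n ^ 'm \<Rightarrow> complex ^ 'm ^ 'n" where
  "conj_transpose A = (\<chi> i j. cnj (A $ j $ i))"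

definition fourier :: "(int \<Rightarrow> real ^ 'n ^ 'm) \<Rightarrow> real \<Rightarrow> complex ^ 'n ^ 'm" where
  "fourier R \<theta> =
     (\<Sum>\<^sub>\<infinity>t\<in>UNIV. exp (- (\<i> * complex_of_real \<theta> * of_int t)) *\<^sub>C cmat (R t))"

definition fourier_vec :: "(int \<Rightarrow> real ^ 'n) \<Rightarrow> real \<Rightarrow> complex ^ 'n" where
  "fourier_vec r \<theta> =
     (\<Sum>\<^sub>\<infinity>t\<in>UNIV. exp (- (\<i> * complex_of_real \<theta> * of_int t)) *s cvec (r t))"


section \<open>Markov chains\<close>

definition row_stochastic :: "real ^ 'd ^ 'd \<Rightarrow> bool" where
  "row_stochastic Q \<longleftrightarrow> (\<forall>i j. 0 \<le> Q $ i $ j) \<and> (\<forall>i. (\<Sum>j\<in>UNIV. Q $ i $ j) = 1)"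

definition irreducible_matrix :: "real ^ 'd ^ 'd \<Rightarrow> bool" where
  "irreducible_matrix Q \<longleftrightarrow> (\<forall>i j. \<exists>n. 0 < mpow Q n $ i $ j)"

definition aperiodic_matrix :: "real ^ 'd ^ 'd \<Rightarrow> bool" where
  "aperiodic_matrix Q \<longleftrightarrow> (\<forall>i. Gcd {n. 0 < n \<and> 0 < mpow Q n $ i $ i} = (1::nat))"

definition invariant_prob_vec :: "real ^ 'd ^ 'd \<Rightarrow> real ^ 'd \<Rightarrow> bool" where
  "invariant_prob_vec Q p \<longleftrightarrow> (\<forall>i. 0 \<le> p $ i) \<and> (\<Sum>i\<in>UNIV. p $ i) = 1 \<and> p v* Q = p"

definition dP :: "(real \<Rightarrow> real ^ 'd ^ 'd) \<Rightarrow> real \<Rightarrow> real ^ 'd ^ 'd" where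
  "dP P \<zeta> = vector_derivative P (at \<zeta>)"

definition ddP :: "(real \<Rightarrow> real ^ 'd ^ 'd) \<Rightarrow> real \<Rightarrow> real ^ 'd ^ 'd" where
  "ddP P \<zeta> = vector_derivative (dP P) (at \<zeta>)"

definition assumption_A1 :: "(real \<Rightarrow> real ^ 'd ^ 'd) \<Rightarrow> bool" where
  "assumption_A1 P \<longleftrightarrow>
     irreducible_matrix (P 0) \<and> aperiodic_matrix (P 0) \<and>
     (\<exists>\<delta>>0. (\<forall>\<zeta>\<in>ball 0 \<delta>. P differentiable (at \<zeta>)) \<and>
            (\<forall>\<zeta>\<in>ball 0 \<delta>. dP P differentiable (at \<zeta>)) \<and>
            continuous_on (ball 0 \<delta>) (ddP P) \<and>
            (\<exists>L. L-lipschitz_on (ball 0 \<delta>) (ddP P)))"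


section \<open>Stationary processes and the controlled process\<close>

definition stationary_process ::
    "'a measure \<Rightarrow> 'b measure \<Rightarrow> (int \<Rightarrow> 'a \<Rightarrow> 'b) \<Rightarrow> bool" where
  "stationary_process M N X \<longleftrightarrow>
     (\<forall>t. X t \<in> measurable M N) \<and>
     (\<forall>k. distr M (\<Pi>\<^sub>M t\<in>UNIV. N) (\<lambda>\<omega> t. X (t + k) \<omega>) =
          distr M (\<Pi>\<^sub>M t\<in>UNIV. N) (\<lambda>\<omega> t. X t \<omega>))"

definition autocov :: "'a measure \<Rightarrow> (int \<Rightarrow> 'a \<Rightarrow> real) \<Rightarrow> int \<Rightarrow> real" where
  "autocov M X t = (LINT \<omega>|M. X t \<omega> * X 0 \<omega>)"

text \<open>The condition on \<open>\<zeta>\<^sup>1\<close>; the scaling \<open>\<zeta>\<^sub>t = \<epsilon> \<zeta>\<^sup>1\<^sub>t\<close> is applied where the condition is used.\<close>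

definition assumption_A2 :: "'a measure \<Rightarrow> (int \<Rightarrow> 'a \<Rightarrow> real) \<Rightarrow> bool" where
  "assumption_A2 M Z \<longleftrightarrow>
     stationary_process M borel Z \<and>
     (\<forall>t. (LINT \<omega>|M. Z t \<omega>) = 0) \<and>
     (AE \<omega> in M. \<forall>t. \<bar>Z t \<omega>\<bar> \<le> 1) \<and>
     summable (\<lambda>t::nat. \<bar>autocov M Z (int t)\<bar>)"

text \<open>The sigma-algebra generated by \<open>X\<^sub>s\<close> and \<open>\<zeta>\<^sub>s\<close> for \<open>s \<le> t\<close>.\<close>

definition past_algebra ::
    "'a measure \<Rightarrow> (int \<Rightarrow> 'a \<Rightarrow> real) \<Rightarrow> (int \<Rightarrow> 'a \<Rightarrow> 'd) \<Rightarrow> int \<Rightarrow> 'a measure" where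
  "past_algebra M \<zeta> X t =
     vimage_algebra (space M) (\<lambda>\<omega>. \<lambda>s\<in>{..t}. (\<zeta> s \<omega>, X s \<omega>))
       (\<Pi>\<^sub>M s\<in>{..t}. borel \<Otimes>\<^sub>M count_space UNIV)"

text \<open>\<open>X\<close> is stationary jointly with the input \<open>\<zeta>\<close>, and moves from \<open>X\<^sub>t\<close> according to
  the transition matrix \<open>P\<close> at \<open>\<zeta>\<^sub>t\<close>, given the past.\<close>

definition stationary_controlled_process ::
    "'a measure \<Rightarrow> (real \<Rightarrow> real ^ 'd ^ 'd) \<Rightarrow> (int \<Rightarrow> 'a \<Rightarrow> real) \<Rightarrow> (int \<Rightarrow> 'a \<Rightarrow> 'd::finite) \<Rightarrow> bool"
  where
  "stationary_controlled_process M P \<zeta> X \<longleftrightarrow>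
     stationary_process M (borel \<Otimes>\<^sub>M count_space UNIV) (\<lambda>t \<omega>. (\<zeta> t \<omega>, X t \<omega>)) \<and>
     (\<forall>t j. AE \<omega> in M.
        real_cond_exp M (past_algebra M \<zeta> X t) (\<lambda>\<omega>'. indicator {j} (X (t + 1) \<omega>')) \<omega>
          = P (\<zeta> t \<omega>) $ X t \<omega> $ j)"


section \<open>Second-order approximations of the correlations\<close>

text \<open>Throughout, \<open>R\<close> stands for the autocovariance of \<open>\<zeta>\<close>.\<close>

context
  fixes P :: "real \<Rightarrow> real ^ 'd ^ 'd" and R :: "int \<Rightarrow> real"
begin

definition pi0 :: "real ^ 'd" where
  "pi0 = (THE p. invariant_prob_vec (P 0) p)"

definition ones_pi0 :: "real ^ 'd ^ 'd" where
  "ones_pi0 = (\<chi> i. pi0)"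

definition Pi0 :: "real ^ 'd ^ 'd" where
  "Pi0 = diag pi0"

definition EE :: "real ^ 'd ^ 'd" where
  "EE = dP P 0"

definition WW :: "real ^ 'd ^ 'd" where
  "WW = ddP P 0"

definition BB :: "real ^ 'd" where
  "BB = pi0 v* EE"

definition U1 :: "real ^ 'd ^ 'd" where
  "U1 = matrix_inv (mat 1 - P 0 + ones_pi0)"

definition AA :: "real ^ 'd ^ 'd" where
  "AA = transpose (P 0)"

definition Atilde :: "real ^ 'd ^ 'd" where
  "Atilde = transpose (P 0 - ones_pi0)"

definition Rhat_Gamma_zeta :: "int \<Rightarrow> real ^ 'd" where
  "Rhat_Gamma_zeta t = (\<Sum>\<^sub>\<infinity>i\<in>{1..}. R (t - int i) *\<^sub>R (BB v* mpow (P 0) (i - 1)))"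

definition xi_hat :: "real ^ 'd" where
  "xi_hat = Rhat_Gamma_zeta 0 v* EE + (1/2 * R 0) *\<^sub>R (pi0 v* WW)"

definition pi_hat :: "real ^ 'd" where
  "pi_hat = pi0 + xi_hat v* U1"

definition Pi_hat :: "real ^ 'd ^ 'd" where
  "Pi_hat = diag pi_hat"

definition Sigma_Delta_bullet :: "real ^ 'd ^ 'd" where
  "Sigma_Delta_bullet = Pi0 - transpose (P 0) ** Pi0 ** P 0"

text \<open>Used only at arguments \<open>s \<le> 0\<close>.\<close>

definition Rhat_Delta2_zeta :: "int \<Rightarrow> real ^ 'd ^ 'd" where
  "Rhat_Delta2_zeta s =
     diag (Rhat_Gamma_zeta (s - 1) v* P 0)
     - transpose (P 0) ** diag (Rhat_Gamma_zeta (s - 1)) ** P 0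
     + R (- s + 1) *\<^sub>R
         (diag (pi0 v* EE)
          - (transpose (P 0) ** Pi0 ** EE + transpose (transpose (P 0) ** Pi0 ** EE)))"

definition Rhat_Bzeta :: "int \<Rightarrow> real ^ 'd ^ 'd" where
  "Rhat_Bzeta t =
     (let f = (\<lambda>s. R s *\<^sub>R (transpose (mpow (P 0) (nat s) ** EE) ** Pi0 ** EE))
      in if t \<ge> 0 then f t else transpose (f (- t)))"

definition Rhat_Delta :: "int \<Rightarrow> real ^ 'd ^ 'd" where
  "Rhat_Delta t =
     (if t = 0 then
        Pi_hat - transpose (P 0) ** Pi_hat ** P 0
        - (transpose (P 0) ** diag (Rhat_Gamma_zeta 0) ** EE
           + transpose EE ** diag (Rhat_Gamma_zeta 0) ** P 0)
        - (1/2 * R 0) *\<^sub>R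
            (transpose (P 0) ** Pi0 ** WW
             + 2 *\<^sub>R (transpose EE ** Pi0 ** EE)
             + transpose WW ** Pi0 ** P 0)
      else 0)"

text \<open>At \<open>t = 0\<close> the inner sum is empty and the power is the identity.\<close>

definition Rhat_Bzeta_Delta :: "int \<Rightarrow> real ^ 'd ^ 'd" where
  "Rhat_Bzeta_Delta t =
     (if t < 0 then 0
      else transpose EE ** mpow AA (nat t) ** Rhat_Delta2_zeta (- t)
           + transpose EE **
             (\<Sum>i<nat t. R (t - int i) *\<^sub>R
                (mpow AA (nat t - 1 - i) ** transpose EE ** mpow AA i ** Sigma_Delta_bullet)))"

definition Rhat_Vzeta2_Delta :: "int \<Rightarrow> real ^ 'd ^ 'd" where
  "Rhat_Vzeta2_Delta t =
     (if t < 0 then 0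
      else (1/2 * R 0) *\<^sub>R (transpose (mpow (P 0) (nat t) ** WW) ** Sigma_Delta_bullet))"

definition Rhat_D :: "int \<Rightarrow> real ^ 'd ^ 'd" where
  "Rhat_D t =
     Rhat_Bzeta t + Rhat_Delta t
     + Rhat_Bzeta_Delta (t - 1) + transpose (Rhat_Bzeta_Delta (- t - 1))
     + Rhat_Vzeta2_Delta (t - 1) + transpose (Rhat_Vzeta2_Delta (- t - 1))"

definition Sigma_hat_Gamma :: "int \<Rightarrow> real ^ 'd ^ 'd" where
  "Sigma_hat_Gamma t =
     (\<Sum>\<^sub>\<infinity>(i, k)\<in>(UNIV::nat set) \<times> (UNIV::nat set).
        mpow Atilde i ** Rhat_D (t - int i + int k) ** transpose (mpow Atilde k))"

definition Sigma_hat_Gamma_D :: "int \<Rightarrow> real ^ 'd ^ 'd" where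
  "Sigma_hat_Gamma_D t = (\<Sum>\<^sub>\<infinity>i\<in>(UNIV::nat set). mpow Atilde i ** Rhat_D (t - int i))"

definition Shat_Delta :: "real \<Rightarrow> complex ^ 'd ^ 'd" where
  "Shat_Delta = fourier Rhat_Delta"

definition Shat_Bzeta :: "real \<Rightarrow> complex ^ 'd ^ 'd" where
  "Shat_Bzeta = fourier Rhat_Bzeta"

definition Shat_Bzeta_Delta :: "real \<Rightarrow> complex ^ 'd ^ 'd" where
  "Shat_Bzeta_Delta = fourier Rhat_Bzeta_Delta"

definition Shat_Vzeta2_Delta :: "real \<Rightarrow> complex ^ 'd ^ 'd" where
  "Shat_Vzeta2_Delta = fourier Rhat_Vzeta2_Delta"

definition Shat_D :: "real \<Rightarrow> complex ^ 'd ^ 'd" where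
  "Shat_D = fourier Rhat_D"

definition Shat_Gamma :: "real \<Rightarrow> complex ^ 'd ^ 'd" where
  "Shat_Gamma = fourier Sigma_hat_Gamma"

definition Shat_Gamma_D :: "real \<Rightarrow> complex ^ 'd ^ 'd" where
  "Shat_Gamma_D = fourier Sigma_hat_Gamma_D"

end

text \<open>Here the autocovariance \<open>R1\<close> is that of \<open>\<zeta>\<^sup>1\<close>, not of \<open>\<zeta> = \<epsilon> \<zeta>\<^sup>1\<close>.\<close>

definition Sigma_hat_Gamma_zeta ::
    "(real \<Rightarrow> real ^ 'd ^ 'd) \<Rightarrow> real \<Rightarrow> (int \<Rightarrow> real) \<Rightarrow> int \<Rightarrow> real ^ 'd" where
  "Sigma_hat_Gamma_zeta P \<epsilon> R1 t =
     \<epsilon>^2 *\<^sub>R (\<Sum>\<^sub>\<infinity>i\<in>{1..}. R1 (t - int i) *\<^sub>R (mpow (Atilde P) (i - 1) *v BB P))"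

definition Shat_Gamma_zeta ::
    "(real \<Rightarrow> real ^ 'd ^ 'd) \<Rightarrow> real \<Rightarrow> (int \<Rightarrow> real) \<Rightarrow> real \<Rightarrow> complex ^ 'd" where
  "Shat_Gamma_zeta P \<epsilon> R1 = fourier_vec (Sigma_hat_Gamma_zeta P \<epsilon> R1)"

text \<open>With the kernel \<open>e\<^bsup>-j\<theta>t\<^esup>\<close>, convolution with the powers of \<open>Atilde\<close> has transfer function
  \<open>\<Sum>i. e\<^bsup>-j\<theta>i\<^esup> Atilde\<^bsup>i\<^esup> = [I - e\<^bsup>-j\<theta>\<^esup> Atilde]\<^bsup>-1\<^esup>\<close>.  The printed source has
  \<open>[I e\<^bsup>-j\<theta>\<^esup> - Atilde]\<^bsup>-1\<^esup>\<close>, which is not the transform of these covariances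
  (the statement therefore uses the former; for \<open>Shat_Gamma\<close> the two forms differ by \<open>\<theta> \<mapsto> -\<theta>\<close> in the filters): for
  \<open>EE = WW = 0\<close>, \<open>d = 2\<close> and symmetric \<open>P 0\<close> with second eigenvalue \<open>\<lambda>\<close>, the spectrum
  \<open>Shat_Gamma_D\<close> on the vector \<open>(1,-1)\<close> is \<open>(1 - \<lambda>\<^sup>2) / (2 (1 - \<lambda> e\<^bsup>-j\<theta>\<^esup>))\<close> and not
  \<open>(1 - \<lambda>\<^sup>2) / (2 (e\<^bsup>-j\<theta>\<^esup> - \<lambda>))\<close>.\<close>

end

theory Submission
  imports Defs
begin

text \<open>
  The powers of \<open>Atilde\<close> are absolutely summable: an irreducible aperiodic stochastic matrix has a
  positive power, which contracts the oscillation \<open>max v - min v\<close> of column vectors by a factor less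
  than 1.  The powers of \<open>P 0\<close> itself do not decay, but wherever decay is needed they are multiplied
  by something that annihilates the rank-one limit \<open>ones_pi0\<close>: the entries of \<open>BB\<close> sum to 0 because
  the rows of \<open>P \<zeta>\<close> sum to 1 for all \<open>\<zeta>\<close>, and the columns of \<open>Sigma_Delta_bullet\<close> sum to 0 by
  invariance of \<open>pi0\<close>.  Hence all approximate correlations are absolutely summable convolutions,
  Fourier sums may be interchanged with the sums over powers of \<open>Atilde\<close>, and the latter become
  Neumann series.
\<close>

section \<open>Primitivity and contraction of stochastic matrices\<close>

text \<open>An infinite sum that diverges is 0 by default, and \<open>matrix_inv\<close> of a
  singular matrix is unspecified, so each spectral identity has its meaning only together with
  convergence and invertibility; these make up most of the work. The oscillation is the right
  seminorm because it ignores constant vectors, the direction in which a stochastic matrix cannot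
  contract; the same estimate also produces the invariant vector. The norm of \<open>Atilde\<close>
  itself may exceed 1, hence summability of its powers replaces a norm bound. All interchanges of
  sums go back to one shear of the index set, which turns a convolution into a product family. The
  delicate correlation is \<open>Rhat_Bzeta_Delta\<close>: its inner sum contains two powers of
  \<open>AA\<close>, one tamed by the decay of \<open>R\<close>, the other by
  \<open>Sigma_Delta_bullet\<close>.\<close>

lemma matrix_diff_ldistrib: "A ** (B - C) = A ** B - A ** (C :: 'a::ring_1 ^ 'n ^ 'm)"
  by (simp add: matrix_matrix_mult_def vec_eq_iff right_diff_distrib sum_subtractf)

lemma matrix_diff_rdistrib: "(A - B) ** C = A ** C - B ** (C :: 'a::ring_1 ^ 'n ^ 'm)"
  by (simp add: matrix_matrix_mult_def vec_eq_iff left_diff_distrib sum_subtractf)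

text \<open>The least positive difference \<open>h\<close> of two elements divides every element,
  since otherwise a remainder would be a smaller positive difference. So \<open>h = 1\<close>, and
  the consecutive elements \<open>a\<close> and \<open>a + 1\<close> generate every large
  number.\<close>

lemma additive_set_cofinite:
  fixes S :: "nat set"
  assumes add: "\<And>a b. a \<in> S \<Longrightarrow> b \<in> S \<Longrightarrow> a + b \<in> S" and gcd1: "Gcd S = 1"
  shows "\<exists>N. \<forall>n\<ge>N. n \<in> S"
proof -
  have "\<exists>s\<in>S. s \<noteq> 0"
  proof (rule ccontr)
    assume "\<not> (\<exists>s\<in>S. s \<noteq> 0)"
    then have "S \<subseteq> {0}" by blast
    then have "Gcd S = 0" by (rule Gcd_0_iff[THEN iffD2])
    with gcd1 show False by simp
  qed
  then obtain s where s: "s \<in> S" "s > 0" by auto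
  \<comment> \<open>\<open>0\<close> need not lie in \<open>S\<close>, so only positive multiples
    are available.\<close>
  have mult: "a \<in> S \<Longrightarrow> Suc k * a \<in> S" for a k
    by (induction k) (auto intro: add)
  define H where "H = {d::nat. \<exists>a\<in>S. a + d \<in> S}"
  define h where "h = (LEAST d. d \<in> H \<and> d > 0)"
  have "s \<in> H \<and> s > 0" using s add by (auto simp: H_def)
  then have h: "h \<in> H" "h > 0" and h_le: "\<And>d. d \<in> H \<Longrightarrow> d > 0 \<Longrightarrow> h \<le> d"
    using LeastI[of "\<lambda>d. d \<in> H \<and> d > 0" s] Least_le[of "\<lambda>d. d \<in> H \<and> d > 0"]
    unfolding h_def[symmetric] by blast+
  obtain a where a: "a \<in> S" "a + h \<in> S" using h by (auto simp: H_def)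
  have "h dvd x" if x: "x \<in> S" for x
  proof (rule ccontr)
    assume "\<not> h dvd x"
    then have r: "x mod h > 0" by (auto simp: dvd_eq_mod_eq_0)
    define q where "q = x div h"
    have x_eq: "x = q * h + x mod h" by (simp add: q_def)
    \<comment> \<open>This element and \<open>Suc q * a + x\<close> differ by exactly
      \<open>x mod h\<close>; the extra \<open>a\<close> covers \<open>q = 0\<close>.\<close>
    have 1: "q * (a + h) + a \<in> S"
      using a mult[OF a(2)] add by (cases q) auto
    have "Suc q * a + x \<in> S"
      using mult[OF a(1)] x add by blast
    moreover have "Suc q * a + x = q * (a + h) + a + x mod h"
    proof -
      have "Suc q * a + x = Suc q * a + (q * h + x mod h)" using x_eq by metis
      then show ?thesis by (simp add: algebra_simps)
    qed
    ultimately have "q * (a + h) + a + x mod h \<in> S" by metis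
    then have "x mod h \<in> H" using 1 unfolding H_def by blast
    from h_le[OF this r] h(2) show False using mod_less_divisor[of h x] by linarith
  qed
  then have "h dvd Gcd S" by (rule Gcd_greatest)
  with gcd1 a have a1: "a + 1 \<in> S" by simp
  show ?thesis
  proof (intro exI allI impI)
    \<comment> \<open>The part \<open>a * a + a\<close> forces \<open>n div a > a\<close> when
      \<open>a\<close> is positive; the summand \<open>s\<close> makes \<open>n\<close> positive
      when \<open>a = 0\<close>.\<close>
    fix n assume n: "n \<ge> a * a + a + s"
    show "n \<in> S"
    proof (cases "a = 0")
      case True
      then show ?thesis using a1 mult[OF a1, of "n - 1"] n s by simp
    next
      case False
      have r: "n mod a < a" using False by simp
      have q: "n div a > a" 
      proof -
        have "(a * a + a) div a \<le> n div a" using n by (intro div_le_mono) simp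
        then show ?thesis using False by simp
      qed
      obtain k where k: "n div a = n mod a + Suc k" using r q less_imp_Suc_add[of "n mod a" "n div a"] by auto
      \<comment> \<open>Of the \<open>n div a\<close> copies of \<open>a\<close> in
        \<open>n\<close>, exactly \<open>n mod a\<close> absorb one unit of the remainder
        each.\<close>
      have "n = n mod a * (a + 1) + Suc k * a"
      proof -
      have "n = (n mod a + Suc k) * a + n mod a"
        using div_mult_mod_eq[of n a] unfolding k by (rule sym)
      then show ?thesis by (simp add: algebra_simps)
    qed
      moreover have "n mod a * (a + 1) + Suc k * a \<in> S"
      proof (cases "n mod a")
        case 0
        then show ?thesis using mult[OF a(1), of k] by simp
      next
        case (Suc m)
        show ?thesis unfolding Suc by (intro add mult a a1)
      qed
      ultimately show ?thesis by simp
    qed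
  qed
qed

section \<open>Matrix powers and positivity of stochastic powers\<close>

lemma mpow_add: "mpow A (m + n) = mpow A m ** mpow (A :: 'a::comm_semiring_1 ^ 'd ^ 'd) n"
  by (induction m) (simp_all add: matrix_mul_assoc)

lemma mpow_commute: "mpow A n ** A = A ** mpow (A :: 'a::comm_semiring_1 ^ 'd ^ 'd) n"
  using mpow_add[of A n 1] by simp

lemma mpow_transpose:
  "mpow (transpose A) n = transpose (mpow (A :: 'a::comm_semiring_1 ^ 'd ^ 'd) n)"
proof (induction n)
  case (Suc n)
  have "transpose (mpow A (Suc n)) = transpose (mpow A n ** A)" by (simp add: mpow_commute)
  then show ?case by (simp only: mpow.simps matrix_transpose_mul Suc)
qed (simp add: transpose_mat)

lemma row_stochastic_mult:
  assumes "row_stochastic A" "row_stochastic B" shows "row_stochastic (A ** B)"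
proof -
  have "(\<Sum>j\<in>UNIV. (A ** B) $ i $ j) = 1" for i
  proof -
    have "(\<Sum>j\<in>UNIV. (A ** B) $ i $ j) = (\<Sum>k\<in>UNIV. A $ i $ k * (\<Sum>j\<in>UNIV. B $ k $ j))"
      by (simp add: matrix_matrix_mult_def sum_distrib_left) (rule sum.swap)
    then show ?thesis using assms by (simp add: row_stochastic_def)
  qed
  moreover have "0 \<le> (A ** B) $ i $ j" for i j
    using assms by (simp add: matrix_matrix_mult_def row_stochastic_def sum_nonneg)
  ultimately show ?thesis by (simp add: row_stochastic_def)
qed

lemma row_stochastic_mpow: "row_stochastic A \<Longrightarrow> row_stochastic (mpow A n)"
proof (induction n)
  case 0
  show ?case by (simp add: row_stochastic_def mat_def if_distrib cong: if_cong)
qed (simp add: row_stochastic_mult)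

lemma mpow_add_pos:
  fixes Q :: "real ^ 'd ^ 'd"
  assumes Q: "row_stochastic Q" and "0 < mpow Q m $ i $ j" "0 < mpow Q n $ j $ k"
  shows "0 < mpow Q (m + n) $ i $ k"
proof -
  have nn: "0 \<le> mpow Q n $ a $ b" for n a b
    using row_stochastic_mpow[OF Q] by (simp add: row_stochastic_def)
  have "0 < mpow Q m $ i $ j * mpow Q n $ j $ k" using assms by simp
  also have "\<dots> \<le> (\<Sum>l\<in>UNIV. mpow Q m $ i $ l * mpow Q n $ l $ k)"
    using nn by (intro member_le_sum) auto
  finally show ?thesis by (simp add: mpow_add matrix_matrix_mult_def)
qed

text \<open>Aperiodicity provides closed walks at \<open>i\<close> of every large length; prefixing
  one to a fixed walk of length \<open>l i j\<close> from \<open>i\<close> to \<open>j\<close>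
  realises every large total length.\<close>

lemma irreducible_aperiodic_primitive:
  fixes Q :: "real ^ 'd ^ 'd"
  assumes Q: "row_stochastic Q" and irr: "irreducible_matrix Q" and ap: "aperiodic_matrix Q"
  shows "\<exists>N. \<forall>n\<ge>N. \<forall>i j. 0 < mpow Q n $ i $ j"
proof -
  have "\<exists>N. \<forall>n\<ge>N. 0 < mpow Q n $ i $ i" for i
  proof -
    have "\<exists>N. \<forall>n\<ge>N. n \<in> {n. 0 < n \<and> 0 < mpow Q n $ i $ i}"
      using ap mpow_add_pos[OF Q]
      by (intro additive_set_cofinite) (auto simp: aperiodic_matrix_def)
    then show ?thesis by auto
  qed
  then obtain N where N: "\<And>i n. n \<ge> N i \<Longrightarrow> 0 < mpow Q n $ i $ i" by metis
  obtain l where l: "\<And>i j. 0 < mpow Q (l i j) $ i $ j"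
    using irr unfolding irreducible_matrix_def by metis
  \<comment> \<open>Sums serve in place of maxima: \<open>m\<close> dominates
    \<open>N i + l i j\<close> for all \<open>i\<close> and \<open>j\<close> at once.\<close>
  define m where "m = (\<Sum>i\<in>UNIV. N i) + (\<Sum>i\<in>UNIV. \<Sum>j\<in>UNIV. l i j)"
  have "0 < mpow Q n $ i $ j" if n: "n \<ge> m" for n i j
  proof -
    have "N i \<le> (\<Sum>i\<in>UNIV. N i)" by (rule member_le_sum) auto
    moreover have "l i j \<le> (\<Sum>j\<in>UNIV. l i j)" by (rule member_le_sum) auto
    moreover have "(\<Sum>j\<in>UNIV. l i j) \<le> (\<Sum>i\<in>UNIV. \<Sum>j\<in>UNIV. l i j)"
      by (rule member_le_sum) auto
    ultimately have "N i + l i j \<le> n" using n unfolding m_def by linarith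
    then have "0 < mpow Q (n - l i j) $ i $ i" by (intro N) simp
    from mpow_add_pos[OF Q this l[of i j]] \<open>N i + l i j \<le> n\<close> show ?thesis by simp
  qed
  then show ?thesis by blast
qed

section \<open>Oscillation of column vectors under stochastic matrices\<close>

definition osc :: "real ^ 'd \<Rightarrow> real" where
  "osc v = Max (range (($) v)) - Min (range (($) v))"

lemma osc_ge: "\<bar>v $ i - v $ j\<bar> \<le> osc v"
proof -
  have "v $ k \<le> Max (range (($) v))" "Min (range (($) v)) \<le> v $ k" for k by simp_all
  from this[of i] this[of j] show ?thesis unfolding osc_def by linarith
qed

lemma osc_nonneg: "0 \<le> osc v"
  using osc_ge[of v undefined undefined] by simp

text \<open>Every row puts weight at least \<open>\<delta>\<close> on an index where
  \<open>v\<close> is smallest, so each average lies at least \<open>\<delta> * osc v\<close> below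
  the maximum, while no average falls below the minimum.\<close>

lemma osc_contraction:
  fixes A :: "real ^ 'd ^ 'd"
  assumes A: "row_stochastic A" and \<delta>: "\<And>i j. \<delta> \<le> A $ i $ j"
  shows "osc (A *v v) \<le> (1 - \<delta>) * osc v"
proof -
  define a b where "a = Max (range (($) v))" and "b = Min (range (($) v))"
  have "b \<in> range (($) v)" unfolding b_def by (rule Min_in) auto
  then obtain k where k: "v $ k = b" by auto
  have ab: "v $ i \<le> a" "b \<le> v $ i" for i by (simp_all add: a_def b_def)
  have nn: "0 \<le> A $ i $ j" and one: "(\<Sum>j\<in>UNIV. A $ i $ j) = 1" for i j
    using A by (auto simp: row_stochastic_def)
  have "(A *v v) $ i \<le> a - \<delta> * (a - b)" for i
  proof -
    have "\<delta> * (a - b) \<le> A $ i $ k * (a - v $ k)"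
      unfolding k using \<delta> ab[of k] k by (intro mult_right_mono) auto
    also have "\<dots> \<le> (\<Sum>j\<in>UNIV. A $ i $ j * (a - v $ j))"
      using nn ab by (intro member_le_sum) auto
    also have "\<dots> = a - (A *v v) $ i"
      by (simp add: matrix_vector_mult_def right_diff_distrib sum_subtractf
          sum_distrib_right[symmetric] one)
    finally show ?thesis by simp
  qed
  then have 1: "Max (range (($) (A *v v))) \<le> a - \<delta> * (a - b)" by auto
  have "b \<le> (A *v v) $ i" for i
  proof -
    have "b = (\<Sum>j\<in>UNIV. A $ i $ j * b)" by (simp add: sum_distrib_right[symmetric] one)
    also have "\<dots> \<le> (\<Sum>j\<in>UNIV. A $ i $ j * v $ j)"
      using nn ab by (intro sum_mono mult_left_mono) auto
    finally show ?thesis by (simp add: matrix_vector_mult_def)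
  qed
  then have "b \<le> Min (range (($) (A *v v)))" by auto
  with 1 have "osc (A *v v) \<le> a - \<delta> * (a - b) - b"
    unfolding osc_def by (rule diff_mono)
  also have "\<dots> = (1 - \<delta>) * osc v" by (simp add: osc_def a_def b_def algebra_simps)
  finally show ?thesis .
qed

lemma sum_split_shift: "(\<Sum>n<N + m. u n) = (\<Sum>n<N. u n) + (\<Sum>n<m. u (n + N))"
  for u :: "nat \<Rightarrow> real"
  by (induction m) (simp_all add: add.commute)

text \<open>A partial sum T satisfies T \<le> C + \<open>\<eta>\<close> T, where C is the sum of the
  first \<open>N\<close> terms; solving for T bounds it, without separating residue classes modulo
  \<open>N\<close>.\<close>

lemma summable_contraction:
  fixes u :: "nat \<Rightarrow> real"
  assumes nn: "\<And>n. 0 \<le> u n" and step: "\<And>n. u (n + N) \<le> \<eta> * u n" and \<eta>: "\<eta> < 1"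
  shows "summable u"
proof (rule summableI_nonneg_bounded[OF nn])
  fix m
  have "(\<Sum>n<m. u n) \<le> (\<Sum>n<N + m. u n)" using nn by (intro sum_mono2) auto
  also have "\<dots> = (\<Sum>n<N. u n) + (\<Sum>n<m. u (n + N))"
    by (rule sum_split_shift)
  also have "(\<Sum>n<m. u (n + N)) \<le> \<eta> * (\<Sum>n<m. u n)"
    unfolding sum_distrib_left by (intro sum_mono step)
  finally show "(\<Sum>n<m. u n) \<le> (\<Sum>n<N. u n) / (1 - \<eta>)"
    using \<eta> by (simp add: pos_le_divide_eq algebra_simps)
qed

lemma summable_osc_mpow:
  fixes Q :: "real ^ 'd ^ 'd"
  assumes Q: "row_stochastic Q" "irreducible_matrix Q" "aperiodic_matrix Q"
  shows "summable (\<lambda>n. osc (mpow Q n *v v))"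
proof -
  obtain N where N: "\<And>i j. 0 < mpow Q N $ i $ j"
    using irreducible_aperiodic_primitive[OF Q] by blast
  define \<delta> where "\<delta> = Min (range (\<lambda>(i, j). mpow Q N $ i $ j))"
  have "\<delta> > 0" unfolding \<delta>_def using N by (subst Min_gr_iff) auto
  have "\<delta> \<le> mpow Q N $ i $ j" for i j
    unfolding \<delta>_def by (rule Min_le) (auto intro: range_eqI[of _ _ "(i, j)"])
  from osc_contraction[OF row_stochastic_mpow[OF Q(1)] this]
  have "osc (mpow Q (n + N) *v v) \<le> (1 - \<delta>) * osc (mpow Q n *v v)" for n
    by (simp add: add.commute[of n] mpow_add matrix_vector_mul_assoc[symmetric])
  with \<open>\<delta> > 0\<close> show ?thesis by (intro summable_contraction[where \<eta> = "1 - \<delta>"]) (auto simp: osc_nonneg)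
qed

section \<open>Invariant probability vectors and removal of the rank-one limit\<close>

lemma invariant_prob_vec_mpow: "invariant_prob_vec Q p \<Longrightarrow> p v* mpow Q n = p"
  by (induction n) (simp_all add: invariant_prob_vec_def vector_matrix_mul_assoc[symmetric])

text \<open>By invariance \<open>p $ j\<close> is a \<open>p\<close>-weighted average of column
  \<open>j\<close> of the \<open>n\<close>-th power, and no entry of a column is farther from such
  an average than the spread of the column.\<close>

lemma invariant_prob_vec_osc:
  assumes "invariant_prob_vec Q p"
  shows "\<bar>mpow Q n $ i $ j - p $ j\<bar> \<le> osc (mpow Q n *v axis j 1)"
proof -
  have p: "\<And>k. 0 \<le> p $ k" "(\<Sum>k\<in>UNIV. p $ k) = 1" using assms by (auto simp: invariant_prob_vec_def)
  have col: "(mpow Q n *v axis j 1) $ k = mpow Q n $ k $ j" for k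
    by (simp add: matrix_vector_mult_def axis_def if_distrib cong: if_cong)
  have "p $ j = (\<Sum>k\<in>UNIV. p $ k * mpow Q n $ k $ j)"
    using invariant_prob_vec_mpow[OF assms, of n]
    by (simp add: vector_matrix_mult_def vec_eq_iff mult.commute)
  then have "mpow Q n $ i $ j - p $ j = (\<Sum>k\<in>UNIV. p $ k * (mpow Q n $ i $ j - mpow Q n $ k $ j))"
    by (simp add: right_diff_distrib sum_subtractf sum_distrib_right[symmetric] p)
  also have "\<bar>\<dots>\<bar> \<le> (\<Sum>k\<in>UNIV. p $ k * osc (mpow Q n *v axis j 1))"
    using p osc_ge[of "mpow Q n *v axis j 1"]
    by (intro order.trans[OF sum_abs] sum_mono) (auto simp: abs_mult col intro!: mult_left_mono)
  finally show ?thesis by (simp add: sum_distrib_right[symmetric] p)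
qed

text \<open>Existence: an entry of power \<open>Suc n\<close> averages a column of power
  \<open>n\<close>, so the increments along a fixed row are bounded by summable oscillations, and
  the limit of the row is invariant. Uniqueness: every row converges to each invariant probability
  vector.\<close>

lemma ex1_invariant_prob_vec:
  fixes Q :: "real ^ 'd ^ 'd"
  assumes Q: "row_stochastic Q" "irreducible_matrix Q" "aperiodic_matrix Q"
  shows "\<exists>!p. invariant_prob_vec Q p"
proof -
  \<comment> \<open>An arbitrary row; in the limit all rows agree.\<close>
  define i :: 'd where "i = undefined"
  have osc0: "(\<lambda>n. osc (mpow Q n *v v)) \<longlonglongrightarrow> 0" for v
    by (intro summable_LIMSEQ_zero summable_osc_mpow Q)
  have col: "(mpow Q n *v axis j 1) $ k = mpow Q n $ k $ j" for k n j
    by (simp add: matrix_vector_mult_def axis_def if_distrib cong: if_cong)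
  have st: "0 \<le> mpow Q n $ k $ j" "(\<Sum>j\<in>UNIV. mpow Q n $ k $ j) = 1" for n k j
    using row_stochastic_mpow[OF Q(1), of n] by (auto simp: row_stochastic_def)
  have one: "(\<Sum>j\<in>UNIV. Q $ i $ j) = 1" and nn: "\<And>j. 0 \<le> Q $ i $ j"
    using Q(1) by (auto simp: row_stochastic_def)
  have "\<exists>l. (\<lambda>n. mpow Q n $ i $ j) \<longlonglongrightarrow> l" for j
  proof -
    have "norm (mpow Q (Suc n) $ i $ j - mpow Q n $ i $ j) \<le> osc (mpow Q n *v axis j 1)" for n
    proof -
      have "mpow Q (Suc n) $ i $ j - mpow Q n $ i $ j
          = (\<Sum>k\<in>UNIV. Q $ i $ k * (mpow Q n $ k $ j - mpow Q n $ i $ j))"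
        by (simp add: one matrix_matrix_mult_def right_diff_distrib sum_subtractf sum_distrib_right[symmetric])
      also have "\<bar>\<dots>\<bar> \<le> (\<Sum>k\<in>UNIV. Q $ i $ k * osc (mpow Q n *v axis j 1))"
        using nn osc_ge[of "mpow Q n *v axis j 1"]
        by (intro order.trans[OF sum_abs] sum_mono) (auto simp: abs_mult col intro!: mult_left_mono)
      finally show ?thesis by (simp add: one sum_distrib_right[symmetric])
    qed
    then have "summable (\<lambda>n. mpow Q (Suc n) $ i $ j - mpow Q n $ i $ j)"
      by (rule summable_comparison_test'[OF summable_osc_mpow[OF Q, of "axis j 1"]])
    then have "convergent (\<lambda>n. mpow Q n $ i $ j - mpow Q 0 $ i $ j)"
      unfolding summable_iff_convergent
      by (subst (asm) sum_lessThan_telescope[where f = "\<lambda>n. mpow Q n $ i $ j"])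
    then show ?thesis unfolding convergent_diff_const_right_iff convergent_def .
  qed
  then obtain l where l: "\<And>j. (\<lambda>n. mpow Q n $ i $ j) \<longlonglongrightarrow> l j" by metis
  define p where "p = (\<chi> j. l j)"
  have "0 \<le> l j" for j by (rule LIMSEQ_le_const[OF l]) (auto simp: st(1))
  moreover have "(\<Sum>j\<in>UNIV. l j) = 1"
    using LIMSEQ_unique[OF tendsto_sum[of UNIV "\<lambda>j n. mpow Q n $ i $ j" l, OF l]]
    by (simp add: st)
  moreover have "(\<Sum>k\<in>UNIV. l k * Q $ k $ j) = l j" for j
  proof (rule LIMSEQ_unique)
    show "(\<lambda>n. \<Sum>k\<in>UNIV. mpow Q n $ i $ k * Q $ k $ j) \<longlonglongrightarrow> (\<Sum>k\<in>UNIV. l k * Q $ k $ j)"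
      by (intro tendsto_intros l)
    \<comment> \<open>Invariance needs the new factor \<open>Q\<close> on the right, whereas the
      increments above had it on the left.\<close>
    have eq: "mpow Q (Suc n) $ i $ j = (\<Sum>k\<in>UNIV. mpow Q n $ i $ k * Q $ k $ j)" for n
      by (simp add: mpow_commute[symmetric]) (simp add: matrix_matrix_mult_def)
    show "(\<lambda>n. \<Sum>k\<in>UNIV. mpow Q n $ i $ k * Q $ k $ j) \<longlonglongrightarrow> l j"
      using LIMSEQ_Suc[OF l[of j]] unfolding eq .
  qed
  ultimately have inv: "invariant_prob_vec Q p"
    by (simp add: invariant_prob_vec_def p_def vector_matrix_mult_def vec_eq_iff mult.commute)
  have lim: "(\<lambda>n. mpow Q n $ k $ j) \<longlonglongrightarrow> q $ j" if "invariant_prob_vec Q q" for q k j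
  proof -
    have "(\<lambda>n. mpow Q n $ k $ j - q $ j) \<longlonglongrightarrow> 0"
      by (rule Lim_null_comparison[OF _ osc0[of "axis j 1"]])
        (simp add: invariant_prob_vec_osc[OF that])
    then show ?thesis by (rule LIM_zero_cancel)
  qed
  have "q = p" if "invariant_prob_vec Q q" for q
  proof -
    have "q $ j = p $ j" for j by (rule LIMSEQ_unique[OF lim[OF that] lim[OF inv]])
    then show ?thesis by (simp add: vec_eq_iff)
  qed
  with inv show ?thesis by blast
qed

text \<open>The matrix J with all rows \<open>p\<close> satisfies QJ = JQ = JJ = J, so the cross
  terms collapse. Power 0 must be excluded: there the identity would have to equal the identity
  minus J.\<close>

lemma mpow_sub_rank_one:
  fixes Q :: "real ^ 'd ^ 'd"
  assumes Q: "row_stochastic Q" and p: "invariant_prob_vec Q p"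
  shows "mpow (Q - (\<chi> i. p)) (Suc n) = mpow Q (Suc n) - (\<chi> i. p)"
proof -
  have one: "(\<Sum>j\<in>UNIV. Q $ i $ j) = 1" for i using Q by (simp add: row_stochastic_def)
  have p1: "(\<Sum>j\<in>UNIV. p $ j) = 1" and pQ: "p v* A = (\<chi> j. \<Sum>k\<in>UNIV. p $ k * A $ k $ j)"
    for A :: "real ^ 'd ^ 'd"
    using p by (simp_all add: invariant_prob_vec_def vector_matrix_mult_def mult.commute)
  have QJ: "Q ** (\<chi> i. p) = (\<chi> i. p)"
    by (simp add: matrix_matrix_mult_def vec_eq_iff sum_distrib_right[symmetric] one)
  have J: "(\<chi> i. p) ** A = (\<chi> i. p v* A)" for A :: "real ^ 'd ^ 'd"
    by (simp add: matrix_matrix_mult_def vec_eq_iff pQ)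
  have JJ: "p v* (\<chi> i. p) = p"
    by (simp add: pQ vec_eq_iff sum_distrib_right[symmetric] p1)
  show ?thesis
  proof (induction n)
    case (Suc n)
    have "mpow (Q - (\<chi> i. p)) (Suc (Suc n)) = (Q - (\<chi> i. p)) ** (mpow Q (Suc n) - (\<chi> i. p))"
      unfolding mpow.simps(2)[of _ "Suc n"] Suc ..
    also have "\<dots> = Q ** mpow Q (Suc n) - (\<chi> i. p)"
      unfolding matrix_diff_ldistrib matrix_diff_rdistrib QJ J JJ
        invariant_prob_vec_mpow[OF p, of "Suc n"] by simp
    finally show ?case by simp
  qed simp
qed

lemma summable_norm_mpow_sub_rank_one:
  fixes Q :: "real ^ 'd ^ 'd"
  assumes Q: "row_stochastic Q" "irreducible_matrix Q" "aperiodic_matrix Q"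
    and p: "invariant_prob_vec Q p"
  shows "summable (\<lambda>n. norm (mpow (Q - (\<chi> i. p)) n))"
proof -
  let ?K = "Q - (\<chi> i. p)"
  \<comment> \<open>The summand does not depend on \<open>i\<close>; the outer sum matches the sum
    over all entries that bounds the matrix norm.\<close>
  define c where "c n = (\<Sum>i\<in>(UNIV :: 'd set). \<Sum>j\<in>UNIV. osc (mpow Q n *v axis j 1))" for n
  have "norm (mpow ?K (Suc n)) \<le> c (Suc n)" for n
  proof -
    have "norm (mpow ?K (Suc n)) \<le> (\<Sum>i\<in>UNIV. norm (mpow ?K (Suc n) $ i))"
      unfolding norm_vec_def[of "mpow ?K (Suc n)"] by (rule L2_set_le_sum) simp
    also have "\<dots> \<le> (\<Sum>i\<in>UNIV. \<Sum>j\<in>UNIV. \<bar>mpow ?K (Suc n) $ i $ j\<bar>)"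
      by (intro sum_mono norm_le_l1_cart)
    also have "\<dots> \<le> c (Suc n)"
      unfolding c_def mpow_sub_rank_one[OF Q(1) p] using invariant_prob_vec_osc[OF p, of "Suc n"]
      by (intro sum_mono) (simp del: mpow.simps)
    finally show ?thesis .
  qed
  then have bound: "norm (norm (mpow ?K (Suc n))) \<le> c (Suc n)" for n
    by (simp only: real_norm_def abs_norm_cancel)
  have "summable c"
    unfolding c_def by (rule summable_sum, rule summable_sum, rule summable_osc_mpow[OF Q])
  then have "summable (\<lambda>n. c (Suc n))" by (rule summable_Suc_iff[THEN iffD2])
  from summable_comparison_test'[OF this bound]
  have "summable (\<lambda>n. norm (mpow ?K (Suc n)))" .
  then show ?thesis by (rule summable_Suc_iff[THEN iffD1])
qed

section \<open>Matrix series and convolutions\<close>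

abbreviation norm_summable_on :: "('i \<Rightarrow> 'a::real_normed_vector) \<Rightarrow> 'i set \<Rightarrow> bool"  (infix "norm'_summable'_on" 46)
  where "f norm_summable_on A \<equiv> (\<lambda>x. norm (f x)) summable_on A"

lemma bounded_bilinear_matrix_mult:
  "bounded_bilinear ((**) :: ('a::{euclidean_space,real_normed_field}) ^ 'n ^ 'm \<Rightarrow> 'a ^ 'k ^ 'n \<Rightarrow> 'a ^ 'k ^ 'm)"
  by (rule bilinear_conv_bounded_bilinear[THEN iffD1], unfold bilinear_def)
    (auto intro!: linearI simp: vec_eq_iff matrix_matrix_mult_def distrib_left distrib_right
      sum.distrib scaleR_sum_right)

lemmas bounded_linear_matrix_mult_left = bounded_bilinear.bounded_linear_left[OF bounded_bilinear_matrix_mult]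
lemmas bounded_linear_matrix_mult_right = bounded_bilinear.bounded_linear_right[OF bounded_bilinear_matrix_mult]

lemma infsum_bounded_linear:
  assumes "bounded_linear h" "f summable_on A"
  shows "(\<Sum>\<^sub>\<infinity>x\<in>A. h (f x)) = h (\<Sum>\<^sub>\<infinity>x\<in>A. f x)"
  by (rule infsumI, rule has_sum_bounded_linear[OF assms(1) has_sum_infsum[OF assms(2)]])

text \<open>Splitting off the term of index 0 gives S = 1 + A S, and a one-sided inverse of a square
  matrix is two-sided.\<close>

lemma neumann_series:
  fixes A :: "('a::{euclidean_space,real_normed_field}) ^ 'd ^ 'd"
  assumes A: "(mpow A) norm_summable_on UNIV"
  shows "invertible (mat 1 - A)" and "matrix_inv (mat 1 - A) = (\<Sum>\<^sub>\<infinity>n. mpow A n)"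
proof -
  define S where "S = (\<Sum>\<^sub>\<infinity>n. mpow A n)"
  have summ: "mpow A summable_on UNIV" using A by (rule abs_summable_summable)
  have "(\<Sum>\<^sub>\<infinity>n. mpow A (Suc n)) = A ** S"
    unfolding S_def mpow.simps
    by (rule infsum_bounded_linear[OF bounded_linear_matrix_mult_right summ])
  moreover have "S = mat 1 + (\<Sum>\<^sub>\<infinity>n. mpow A (Suc n))"
  proof -
    have "S = (\<Sum>\<^sub>\<infinity>n\<in>insert 0 (range Suc). mpow A n)"
      unfolding S_def by (rule arg_cong[OF UNIV_nat_eq])
    also have "\<dots> = mpow A 0 + (\<Sum>\<^sub>\<infinity>n\<in>range Suc. mpow A n)"
      by (intro infsum_insert summable_on_subset_banach[OF summ]) auto
    also have "(\<Sum>\<^sub>\<infinity>n\<in>range Suc. mpow A n) = (\<Sum>\<^sub>\<infinity>n. mpow A (Suc n))"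
      by (subst infsum_reindex) (auto simp: o_def)
    finally show ?thesis by simp
  qed
  ultimately have inv: "(mat 1 - A) ** S = mat 1"
    by (simp add: matrix_diff_rdistrib)
  then have inv': "S ** (mat 1 - A) = mat 1"
    by (simp add: matrix_left_right_inverse)
  from inv inv' show "invertible (mat 1 - A)" by (auto simp: invertible_def)
  \<comment> \<open>\<open>matrix_inv\<close> is a choice: its inverse property is extracted first,
    and cancellation then identifies it with \<open>S\<close>.\<close>
  then have "(mat 1 - A) ** matrix_inv (mat 1 - A) = mat 1"
    unfolding invertible_def matrix_inv_def by (rule someI_ex[THEN conjunct1])
  then have "S ** (mat 1 - A) ** matrix_inv (mat 1 - A) = S"
    by (simp add: matrix_mul_assoc[symmetric])
  then show "matrix_inv (mat 1 - A) = S" by (simp add: inv')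
qed

section \<open>Operator-valued convolutions over the integers\<close>

context
  fixes G :: "int \<Rightarrow> 'x::banach" and L :: "'i \<Rightarrow> 'x \<Rightarrow> 'y::banach"
    and c :: "'i \<Rightarrow> real" and s :: "'i \<Rightarrow> int"
  assumes G: "G norm_summable_on UNIV"
    and L: "\<And>i. bounded_linear (L i)" and L_le: "\<And>i x. norm (L i x) \<le> c i * norm x"
    and c_nonneg: "\<And>i. 0 \<le> c i" and c: "c summable_on UNIV"
begin

text \<open>The shear \<open>(t, i) \<mapsto> (i, t - s i)\<close> is a bijection carrying the
  family to one dominated by \<open>c i * norm (G t)\<close>. Arbitrary delays \<open>s\<close> and
  index types cover single filters and pairs of filters alike.\<close>

lemma convolution_abs_summable_prod:
  "(\<lambda>(t, i). L i (G (t - s i))) norm_summable_on UNIV \<times> UNIV"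
proof -
  have "(\<lambda>(i, t). c i * norm (G t)) norm_summable_on UNIV \<times> UNIV"
    unfolding Infinite_Sum.abs_summable_on_Sigma_iff
    using c_nonneg G c by (auto simp: abs_mult infsum_nonneg infsum_cmult_right
        intro!: summable_on_cmult_right summable_on_cmult_left)
  then have "(\<lambda>(i, t). L i (G t)) norm_summable_on UNIV \<times> UNIV"
    by (rule Infinite_Sum.abs_summable_on_comparison_test) (auto intro: order.trans[OF L_le abs_ge_self])
  moreover have "bij_betw (\<lambda>(t, i). (i, t - s i)) (UNIV \<times> UNIV) (UNIV \<times> UNIV)"
    by (rule bij_betwI[where g = "\<lambda>(i, t). (t + s i, i)"]) auto
  ultimately show ?thesis
    using summable_on_reindex_bij_betw[of "\<lambda>(t, i). (i, t - s i)" "UNIV \<times> UNIV" "UNIV \<times> UNIV"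
        "\<lambda>(i, t). norm (L i (G t))"]
    by (simp add: case_prod_unfold)
qed

lemma convolution_abs_summable_inner: "(\<lambda>i. L i (G (t - s i))) norm_summable_on UNIV"
  using convolution_abs_summable_prod unfolding Infinite_Sum.abs_summable_on_Sigma_iff by simp

lemma convolution_summable_inner: "(\<lambda>i. L i (G (t - s i))) summable_on UNIV"
  by (rule abs_summable_summable[OF convolution_abs_summable_inner])

lemma convolution_abs_summable: "(\<lambda>t. \<Sum>\<^sub>\<infinity>i. L i (G (t - s i))) norm_summable_on UNIV"
proof (rule Infinite_Sum.abs_summable_on_comparison_test)
  show "(\<lambda>t. \<Sum>\<^sub>\<infinity>i. norm (L i (G (t - s i)))) norm_summable_on UNIV"
    using convolution_abs_summable_prod unfolding Infinite_Sum.abs_summable_on_Sigma_iff by simp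
  show "norm (\<Sum>\<^sub>\<infinity>i. L i (G (t - s i))) \<le> norm (\<Sum>\<^sub>\<infinity>i. norm (L i (G (t - s i))))" for t
    by (rule order.trans[OF norm_infsum_bound[OF convolution_abs_summable_inner]]) simp
qed

text \<open>After swapping the sums, the one over all integers no longer sees the delay
  \<open>s i\<close>. With the Fourier kernel built into \<open>G\<close> this becomes the
  convolution theorem.\<close>

lemma infsum_convolution: "(\<Sum>\<^sub>\<infinity>t. \<Sum>\<^sub>\<infinity>i. L i (G (t - s i))) = (\<Sum>\<^sub>\<infinity>i. L i (\<Sum>\<^sub>\<infinity>t. G t))"
proof -
  have "(\<Sum>\<^sub>\<infinity>t. L i (G (t - s i))) = L i (\<Sum>\<^sub>\<infinity>t. G t)" for i
  proof -
    have "bij_betw (\<lambda>t. t - s i) UNIV UNIV"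
      by (rule bij_betwI[where g = "\<lambda>t. t + s i"]) auto
    then have "(\<Sum>\<^sub>\<infinity>t. L i (G (t - s i))) = (\<Sum>\<^sub>\<infinity>t. L i (G t))"
      by (rule infsum_reindex_bij_betw)
    also have "\<dots> = L i (\<Sum>\<^sub>\<infinity>t. G t)"
      by (rule infsum_bounded_linear[OF L abs_summable_summable[OF G]])
    finally show ?thesis .
  qed
  then show ?thesis
    using infsum_swap_banach[OF abs_summable_summable[OF convolution_abs_summable_prod]] by simp
qed

end

section \<open>Closure properties of absolute summability\<close>

lemma abs_summable_bounded_linear:
  assumes "bounded_linear h" and f: "f norm_summable_on A"
  shows "(\<lambda>x. h (f x)) norm_summable_on A"
proof -
  obtain K where "\<And>x. norm (h x) \<le> norm x * K"
    using bounded_linear.bounded[OF assms(1)] by blast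
  then have "norm (h (f x)) \<le> norm (norm (f x) * K)" for x
    by (rule order.trans) simp
  moreover have "(\<lambda>x. norm (f x) * K) norm_summable_on A"
    using f by (simp add: abs_mult summable_on_cmult_left)
  ultimately show ?thesis by (rule Infinite_Sum.abs_summable_on_comparison_test[rotated])
qed

lemma abs_summable_bounded_bilinear:
  assumes "bounded_bilinear h" and f: "f norm_summable_on A" and g: "\<And>x. x \<in> A \<Longrightarrow> norm (g x) \<le> C"
  shows "(\<lambda>x. h (g x) (f x)) norm_summable_on A"
proof -
  obtain K where K: "\<And>x y. norm (h x y) \<le> norm x * norm y * K" "0 < K"
    using bounded_bilinear.pos_bounded[OF assms(1)] by blast
  have "norm (h (g x) (f x)) \<le> norm (norm (f x) * (C * K))" if "x \<in> A" for x
  proof -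
    have "norm (h (g x) (f x)) \<le> norm (g x) * norm (f x) * K" by (rule K)
    also have "\<dots> \<le> C * norm (f x) * K"
      using g[OF that] K(2) by (intro mult_right_mono) auto
    also have "\<dots> \<le> norm (norm (f x) * (C * K))" by (simp add: mult_ac abs_ge_self)
    finally show ?thesis .
  qed
  moreover have "(\<lambda>x. norm (f x) * (C * K)) norm_summable_on A"
    using f by (simp add: abs_mult summable_on_cmult_left)
  ultimately show ?thesis by (rule Infinite_Sum.abs_summable_on_comparison_test[rotated])
qed

lemma abs_summable_add:
  fixes f g :: "'i \<Rightarrow> 'a::banach"
  assumes "f norm_summable_on A" "g norm_summable_on A"
  shows "(\<lambda>x. f x + g x) norm_summable_on A"
proof (rule Infinite_Sum.abs_summable_on_comparison_test)
  show "(\<lambda>x. norm (f x) + norm (g x)) norm_summable_on A"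
    using summable_on_add[OF assms] by (simp add: abs_of_nonneg)
  show "norm (f x + g x) \<le> norm (norm (f x) + norm (g x))" for x
    using norm_triangle_ineq[of "f x" "g x"] by simp
qed

lemma abs_summable_int_reflect:
  fixes f :: "int \<Rightarrow> 'a::real_normed_vector"
  assumes "f norm_summable_on UNIV"
  shows "(\<lambda>t. f (a - t)) norm_summable_on UNIV"
proof -
  have "bij_betw (\<lambda>t. a - t) UNIV (UNIV :: int set)"
    by (rule bij_betwI[where g = "\<lambda>t. a - t"]) auto
  from summable_on_reindex_bij_betw[OF this, of "\<lambda>t. norm (f t)"] assms show ?thesis by simp
qed

lemma abs_summable_int_shift:
  fixes f :: "int \<Rightarrow> 'a::real_normed_vector"
  assumes "f norm_summable_on UNIV"
  shows "(\<lambda>t. f (t - a)) norm_summable_on UNIV"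
  using abs_summable_int_reflect[OF abs_summable_int_reflect[OF assms, of 0], of a] by simp

lemma abs_summable_int_nonneg:
  fixes f :: "nat \<Rightarrow> 'a::real_normed_vector"
  assumes f: "f norm_summable_on UNIV"
  shows "(\<lambda>t::int. if t < 0 then 0 else f (nat t)) norm_summable_on UNIV"
proof -
  have "(\<lambda>t. norm (f (nat t))) summable_on range int"
    using f by (subst summable_on_reindex) (auto simp: o_def)
  then show ?thesis
    by (rule summable_on_cong_neutral[THEN iffD1, rotated -1])
      (auto simp: image_iff not_less dest!: zero_le_imp_eq_int)
qed

section \<open>Summability of the approximate correlations\<close>

lemma abs_summable_imp_bounded:
  assumes "f norm_summable_on A"
  obtains C where "\<And>x. x \<in> A \<Longrightarrow> norm (f x) \<le> C"
proof
  fix x assume "x \<in> A"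
  then have "(\<Sum>x\<in>{x}. norm (f x)) \<le> (\<Sum>\<^sub>\<infinity>x\<in>A. norm (f x))"
    by (intro finite_sum_le_infsum assms) auto
  then show "norm (f x) \<le> (\<Sum>\<^sub>\<infinity>x\<in>A. norm (f x))" by simp
qed

lemma linear_transpose: "linear (transpose :: real ^ 'n ^ 'm \<Rightarrow> _)"
  by (rule linearI) (simp_all add: transpose_def vec_eq_iff)

lemma range_Suc: "range Suc = {1..}"
  by (auto simp: image_iff Suc_le_eq gr0_conv_Suc)

lemma infsum_from_1:
  "(\<Sum>\<^sub>\<infinity>i\<in>{1..}. f i) = (\<Sum>\<^sub>\<infinity>n::nat. f (Suc n))"
  using infsum_reindex[of Suc UNIV f] range_Suc by (simp add: o_def)

lemma summable_on_from_1:
  "f summable_on {1..} \<longleftrightarrow> (\<lambda>n::nat. f (Suc n)) summable_on UNIV"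
  using summable_on_reindex[of Suc UNIV f] range_Suc by (simp add: o_def)

text \<open>Gathers what the spectral formulas draw from A1 and A2. Evenness of \<open>R\<close>
  makes \<open>R t\<close> the common factor of both branches of \<open>Rhat_Bzeta\<close>.\<close>

locale linearized_chain =
  fixes P :: "real \<Rightarrow> real ^ 'd ^ 'd" and R :: "int \<Rightarrow> real"
  assumes stochastic: "row_stochastic (P 0)"
    and inv: "invariant_prob_vec (P 0) (pi0 P)"
    and Atilde: "mpow (Atilde P) norm_summable_on UNIV"
    and EE_row_sum: "\<And>i. (\<Sum>j\<in>UNIV. EE P $ i $ j) = 0"
    and R: "R norm_summable_on UNIV"
    and R_even: "\<And>t. R (- t) = R t"
begin

lemma mpow_Atilde: "mpow (Atilde P) n = transpose (mpow (P 0 - ones_pi0 P) n)"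
  by (simp add: Atilde_def mpow_transpose)

lemma mpow_AA: "mpow (AA P) n = transpose (mpow (P 0) n)"
  by (simp add: AA_def mpow_transpose)

text \<open>Separates a summable part from the constant rank-one limit. The splitting starts at
  power 1, since both power sequences begin with the identity.\<close>

lemma mpow_AA_Suc: "mpow (AA P) (Suc n) = mpow (Atilde P) (Suc n) + transpose (ones_pi0 P)"
  unfolding mpow_Atilde mpow_AA ones_pi0_def mpow_sub_rank_one[OF stochastic inv]
  by (simp add: transpose_def vec_eq_iff del: mpow.simps)

lemma mpow_AA_bounded: obtains C where "\<And>n. norm (mpow (AA P) n) \<le> C"
proof -
  obtain C where C: "\<And>n. norm (mpow (Atilde P) n) \<le> C"
    using abs_summable_imp_bounded[OF Atilde] by auto
  have "norm (mpow (AA P) n) \<le> C + norm (transpose (ones_pi0 P))" for n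
  proof (cases n)
    case 0
    then show ?thesis using C[of 0] by (simp add: add_increasing2)
  next
    case (Suc m)
    show ?thesis unfolding Suc mpow_AA_Suc using C[of "Suc m"]
      by (intro order.trans[OF norm_triangle_ineq] add_right_mono)
  qed
  then show ?thesis by (rule that)
qed

text \<open>\<open>transpose (ones_pi0 P)\<close> maps a vector to its entry sum times
  \<open>pi0 P\<close>, hence kills \<open>BB P\<close>. This turns \<open>Rhat_Gamma_zeta\<close>
  into a convolution with an absolutely summable kernel.\<close>

lemma BB_mpow: "BB P v* mpow (P 0) n = mpow (Atilde P) n *v BB P"
proof (cases n)
  case 0
  then show ?thesis by simp
next
  case (Suc m)
  have "(\<Sum>j\<in>UNIV. BB P $ j) = (\<Sum>i\<in>UNIV. pi0 P $ i * (\<Sum>j\<in>UNIV. EE P $ i $ j))"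
    unfolding BB_def vector_matrix_mult_def sum_distrib_left
    by (simp add: mult.commute) (rule sum.swap)
  then have sum: "(\<Sum>j\<in>UNIV. BB P $ j) = 0" by (simp add: EE_row_sum)
  have "transpose (ones_pi0 P) *v BB P = 0"
    using sum by (simp add: transpose_def ones_pi0_def matrix_vector_mult_def vec_eq_iff
        sum_distrib_left[symmetric])
  then have "mpow (AA P) n *v BB P = mpow (Atilde P) n *v BB P"
    unfolding Suc mpow_AA_Suc by (simp add: matrix_vector_mult_add_rdistrib del: mpow.simps)
  then show ?thesis by (simp add: mpow_AA)
qed

lemma abs_summable_mpow_BB: "(\<lambda>n. mpow (Atilde P) n *v BB P) norm_summable_on UNIV"
proof (rule abs_summable_bounded_linear[OF _ Atilde])
  show "bounded_linear (\<lambda>A. A *v BB P)"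
    unfolding linear_conv_bounded_linear[symmetric]
    by (rule linearI) (simp_all add: matrix_vector_mult_add_rdistrib scaleR_matrix_vector_assoc)
qed

lemma Rhat_Gamma_zeta_eq:
  "Rhat_Gamma_zeta P R t = (\<Sum>\<^sub>\<infinity>n. R (t - (int n + 1)) *\<^sub>R (mpow (Atilde P) n *v BB P))"
  unfolding Rhat_Gamma_zeta_def infsum_from_1 BB_mpow by (simp add: add.commute)

lemma Rhat_Gamma_zeta_inner:
  "(\<lambda>i. R (t - int i) *\<^sub>R (BB P v* mpow (P 0) (i - 1))) summable_on {1..}"
  unfolding summable_on_from_1 BB_mpow
  using convolution_summable_inner[of R "\<lambda>n r. r *\<^sub>R (mpow (Atilde P) n *v BB P)"
      "\<lambda>n. norm (mpow (Atilde P) n *v BB P)" t "\<lambda>n. int n + 1"] abs_summable_mpow_BB R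
  by (simp add: bounded_linear_scaleR_left add.commute mult.commute)

lemma Rhat_Gamma_zeta: "Rhat_Gamma_zeta P R norm_summable_on UNIV"
  unfolding Rhat_Gamma_zeta_eq
  by (rule convolution_abs_summable[where c = "\<lambda>n. norm (mpow (Atilde P) n *v BB P)"])
    (simp_all add: bounded_linear_scaleR_left abs_summable_mpow_BB R[unfolded real_norm_def])

text \<open>The sequence is a fixed linear map \<open>h\<close> applied to
  \<open>Rhat_Gamma_zeta\<close>, plus a shift of \<open>R\<close> times a fixed matrix; both parts
  are summable over all integers, so the sign of the argument plays no part.\<close>

lemma Rhat_Delta2_zeta: "(\<lambda>t. Rhat_Delta2_zeta P R (- t)) norm_summable_on UNIV"
proof -
  define h where "h v = diag (v v* P 0) - transpose (P 0) ** diag v ** P 0" for v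
  define C where "C = diag (pi0 P v* EE P)
          - (transpose (P 0) ** Pi0 P ** EE P + transpose (transpose (P 0) ** Pi0 P ** EE P))"
  have "linear h"
    by (rule linearI) (simp_all add: h_def diag_def vec_eq_iff vector_matrix_mult_def
        matrix_matrix_mult_def sum.distrib algebra_simps sum_distrib_left if_distrib
        cong: if_cong)
  then have "bounded_linear h" by (simp add: linear_conv_bounded_linear)
  moreover have "(\<lambda>t. Rhat_Gamma_zeta P R (- t - 1)) norm_summable_on UNIV"
    using abs_summable_int_reflect[OF Rhat_Gamma_zeta, of "-1"] by (simp add: minus_diff_commute)
  ultimately have "(\<lambda>t. h (Rhat_Gamma_zeta P R (- t - 1))) norm_summable_on UNIV"
    by (rule abs_summable_bounded_linear)
  moreover have "(\<lambda>t. R (t + 1) *\<^sub>R C) norm_summable_on UNIV"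
    using abs_summable_bounded_linear[OF bounded_linear_scaleR_left abs_summable_int_shift[OF R, of "-1"]]
    by simp
  ultimately show ?thesis
    unfolding Rhat_Delta2_zeta_def minus_minus h_def[symmetric] C_def[symmetric]
    by (rule abs_summable_add)
qed

lemma AA_Sigma: "mpow (AA P) n ** Sigma_Delta_bullet P = mpow (Atilde P) n ** Sigma_Delta_bullet P"
proof (cases n)
  case (Suc m)
  \<comment> \<open>The all-ones row takes column sums. It is fixed by
    \<open>transpose (P 0)\<close> because the rows of \<open>P 0\<close> sum to 1, and
    \<open>Pi0 P\<close> sends it to \<open>pi0 P\<close>, so the two terms of
    \<open>Sigma_Delta_bullet P\<close> cancel.\<close>
  define u :: "real ^ 'd" where "u = (\<chi> i. 1)"
  have "u v* transpose (P 0) = u"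
    using stochastic by (simp add: u_def row_stochastic_def matrix_vector_mult_def vec_eq_iff)
  moreover have "u v* Pi0 P = pi0 P"
    by (simp add: u_def Pi0_def diag_def vector_matrix_mult_def vec_eq_iff if_distrib cong: if_cong)
  ultimately have "u v* Sigma_Delta_bullet P = 0"
    using inv by (simp add: Sigma_Delta_bullet_def vector_matrix_mult_diff_rdistrib
        vector_matrix_mul_assoc[symmetric] invariant_prob_vec_def)
  then have "transpose (ones_pi0 P) ** Sigma_Delta_bullet P = 0"
    by (simp add: u_def transpose_def ones_pi0_def matrix_matrix_mult_def vector_matrix_mult_def
        vec_eq_iff sum_distrib_left[symmetric])
  then show ?thesis
    unfolding Suc mpow_AA_Suc by (simp add: bounded_bilinear.add_left[OF bounded_bilinear_matrix_mult] del: mpow.simps)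
qed simp

lemma abs_summable_AA_Sigma:
  "(\<lambda>n. A ** mpow (AA P) n ** Sigma_Delta_bullet P) norm_summable_on UNIV"
proof -
  have "A ** mpow (AA P) n ** Sigma_Delta_bullet P
      = A ** (mpow (Atilde P) n ** Sigma_Delta_bullet P)" for n
    by (simp only: matrix_mul_assoc[symmetric] AA_Sigma)
  then show ?thesis
    using abs_summable_bounded_linear[OF bounded_linear_compose[OF
        bounded_linear_matrix_mult_right bounded_linear_matrix_mult_left] Atilde]
    by simp
qed

lemma Rhat_Delta: "Rhat_Delta P R norm_summable_on UNIV"
  by (rule summable_on_cong_neutral[THEN iffD2, OF _ _ _ summable_on_finite[of "{0}"]])
    (auto simp: Rhat_Delta_def)

text \<open>No factor is used to annihilate the rank-one limit here: the decay is that of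
  \<open>R\<close>, and the powers need only be bounded.\<close>

lemma Rhat_Bzeta: "Rhat_Bzeta P R norm_summable_on UNIV"
proof -
  obtain C where C: "\<And>n. norm (mpow (AA P) n) \<le> C" by (rule mpow_AA_bounded) blast
  define F where "F n = transpose (EE P) ** mpow (AA P) n ** (Pi0 P ** EE P)" for n
  have "bounded_linear (\<lambda>A. transpose (EE P) ** A ** (Pi0 P ** EE P))"
    by (intro bounded_linear_compose[OF bounded_linear_matrix_mult_left bounded_linear_matrix_mult_right])
  then obtain K where K: "\<And>A. norm (transpose (EE P) ** A ** (Pi0 P ** EE P)) \<le> norm A * K" "0 < K"
    using bounded_linear.pos_bounded by blast
  obtain T where T: "\<And>A :: real ^ 'd ^ 'd. norm (transpose A) \<le> norm A * T" "0 < T"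
    using bounded_linear.pos_bounded[OF linear_transpose[unfolded linear_conv_bounded_linear]] by blast
  have F: "norm (F n) \<le> C * K" for n
    unfolding F_def using K(2) C by (intro order.trans[OF K(1)] mult_right_mono) auto
  then have FT: "norm (transpose (F n)) \<le> C * K * T" for n
    using T(2) by (intro order.trans[OF T(1)] mult_right_mono) auto
  define g where "g t = (if t \<ge> 0 then F (nat t) else transpose (F (nat (- t))))" for t
  have "norm (g t) \<le> max (C * K) (C * K * T)" for t
    using F[of "nat t"] FT[of "nat (- t)"] by (auto simp: g_def)
  then have "(\<lambda>t. R t *\<^sub>R g t) norm_summable_on UNIV"
    using abs_summable_bounded_bilinear[OF bounded_bilinear.flip[OF bounded_bilinear_scaleR] R] by blast
  moreover have "Rhat_Bzeta P R t = R t *\<^sub>R g t" for t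
    using R_even[of t]
    by (simp add: Rhat_Bzeta_def g_def F_def mpow_AA matrix_transpose_mul matrix_mul_assoc transpose_scalar)
  ultimately show ?thesis by simp
qed

text \<open>In the first term bounded powers multiply the summable \<open>Rhat_Delta2_zeta\<close>.
  The finite sum is a convolution of \<open>H\<close>, which decays through \<open>R\<close>, with
  \<open>Y\<close>, which decays because \<open>Sigma_Delta_bullet P\<close> removes the limit of
  the powers.\<close>

lemma Rhat_Bzeta_Delta: "Rhat_Bzeta_Delta P R norm_summable_on UNIV"
proof -
  obtain C where C: "\<And>n. norm (mpow (AA P) n) \<le> C" by (rule mpow_AA_bounded) blast
  obtain K where K: "\<And>A :: real ^ 'd ^ 'd. norm (transpose (EE P) ** A) \<le> norm A * K" "0 < K"
    using bounded_linear.pos_bounded[OF bounded_linear_matrix_mult_right] by blast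
  have bound: "norm (transpose (EE P) ** mpow (AA P) n) \<le> C * K" for n
    using K(2) C by (intro order.trans[OF K(1)] mult_right_mono) auto
  define f where "f t = transpose (EE P) ** mpow (AA P) (nat t) ** Rhat_Delta2_zeta P R (- t)" for t
  have f: "f norm_summable_on UNIV"
    unfolding f_def
    by (rule abs_summable_bounded_bilinear[OF bounded_bilinear_matrix_mult Rhat_Delta2_zeta bound])
  define Y where "Y n = transpose (EE P) ** mpow (AA P) n ** Sigma_Delta_bullet P" for n
  \<comment> \<open>The cutoff encodes the range \<open>i < nat t\<close>, since
    \<open>t - int i \<ge> 1\<close> holds exactly there; so the infinite convolution equals the
    finite sum.\<close>
  define G where "G m = (if m < 1 then 0 else transpose (EE P) ** mpow (AA P) (nat m - 1))" for m :: int
  define H where "H m = R m *\<^sub>R G m" for m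
  have "0 \<le> C * K" using bound[of 0] by (rule order.trans[OF norm_ge_zero])
  then have "norm (G m) \<le> C * K" for m using bound by (simp add: G_def)
  then have H: "H norm_summable_on UNIV"
    unfolding H_def
    using abs_summable_bounded_bilinear[OF bounded_bilinear.flip[OF bounded_bilinear_scaleR] R] by blast
  obtain M where M: "\<And>A B. norm (A ** B :: real ^ 'd ^ 'd) \<le> norm (A :: real ^ 'd ^ 'd) * norm (B :: real ^ 'd ^ 'd) * M" "0 < M"
    using bounded_bilinear.pos_bounded[OF bounded_bilinear_matrix_mult] by blast
  have conv: "(\<lambda>t. \<Sum>\<^sub>\<infinity>i. H (t - int i) ** Y i :: real ^ 'd ^ 'd) norm_summable_on UNIV"
  proof (rule convolution_abs_summable[OF H bounded_linear_matrix_mult_left])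
    show "norm (x ** Y i) \<le> norm (Y i) * M * norm x" for x :: "real ^ 'd ^ 'd" and i
      using M(1)[of x "Y i"] by (simp add: mult_ac)
    show "0 \<le> norm (Y i) * M" for i using M(2) by simp
    show "(\<lambda>i. norm (Y i) * M) summable_on UNIV"
      unfolding Y_def by (intro summable_on_cmult_left abs_summable_AA_Sigma)
  qed
  have eq: "transpose (EE P) **
             (\<Sum>i<nat t. R (t - int i) *\<^sub>R
                (mpow (AA P) (nat t - 1 - i) ** transpose (EE P) ** mpow (AA P) i ** Sigma_Delta_bullet P))
     = (\<Sum>\<^sub>\<infinity>i. H (t - int i) ** Y i)" for t
  proof -
    have "(\<Sum>\<^sub>\<infinity>i. H (t - int i) ** Y i) = (\<Sum>\<^sub>\<infinity>i\<in>{..<nat t}. H (t - int i) ** Y i)"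
      by (rule infsum_cong_neutral) (auto simp: H_def G_def)
    also have "\<dots> = (\<Sum>i<nat t. H (t - int i) ** Y i)" by simp
    also have "\<dots> = (\<Sum>i<nat t. transpose (EE P) ** (R (t - int i) *\<^sub>R
                (mpow (AA P) (nat t - 1 - i) ** transpose (EE P) ** mpow (AA P) i ** Sigma_Delta_bullet P)))"
    proof (rule sum.cong[OF refl])
      fix i assume i: "i \<in> {..<nat t}"
      then have "nat (t - int i) - 1 = nat t - 1 - i" by auto
      with i have "H (t - int i) = R (t - int i) *\<^sub>R (transpose (EE P) ** mpow (AA P) (nat t - 1 - i))"
        by (auto simp: H_def G_def)
      then show "H (t - int i) ** Y i = transpose (EE P) ** (R (t - int i) *\<^sub>R
                (mpow (AA P) (nat t - 1 - i) ** transpose (EE P) ** mpow (AA P) i ** Sigma_Delta_bullet P))"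
        by (simp add: Y_def matrix_mul_assoc bounded_bilinear.scaleR_left[OF bounded_bilinear_matrix_mult]
            bounded_bilinear.scaleR_right[OF bounded_bilinear_matrix_mult])
    qed
    also have "\<dots> = transpose (EE P) **
             (\<Sum>i<nat t. R (t - int i) *\<^sub>R
                (mpow (AA P) (nat t - 1 - i) ** transpose (EE P) ** mpow (AA P) i ** Sigma_Delta_bullet P))"
      by (rule bounded_bilinear.sum_right[OF bounded_bilinear_matrix_mult, symmetric])
    finally show ?thesis by simp
  qed
  show ?thesis
  \<comment> \<open>Domination instead of equality: for \<open>t < 0\<close> the correlation is 0 by
    definition, but \<open>f t\<close> need not vanish.\<close>
  proof (rule Infinite_Sum.abs_summable_on_comparison_test)
    show "(\<lambda>t. f t + (\<Sum>\<^sub>\<infinity>i. H (t - int i) ** Y i)) norm_summable_on UNIV"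
      by (rule abs_summable_add[OF f conv])
    show "norm (Rhat_Bzeta_Delta P R t) \<le> norm (f t + (\<Sum>\<^sub>\<infinity>i. H (t - int i) ** Y i))" for t
      unfolding eq[symmetric] by (simp add: Rhat_Bzeta_Delta_def f_def)
  qed
qed

text \<open>The input enters only through the constant \<open>R 0\<close>, so all decay must come
  from \<open>Sigma_Delta_bullet P\<close> removing the limit of the powers.\<close>

lemma Rhat_Vzeta2_Delta: "Rhat_Vzeta2_Delta P R norm_summable_on UNIV"
proof -
  have "(\<lambda>n. (1/2 * R 0) *\<^sub>R (transpose (WW P) ** mpow (AA P) n ** Sigma_Delta_bullet P)) norm_summable_on UNIV"
    by (rule abs_summable_bounded_linear[OF bounded_linear_scaleR_right abs_summable_AA_Sigma])
  from abs_summable_int_nonneg[OF this] show ?thesis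
    unfolding Rhat_Vzeta2_Delta_def matrix_transpose_mul mpow_AA .
qed

lemma abs_summable_transpose_reflect:
  assumes "f norm_summable_on UNIV"
  shows "(\<lambda>t::int. transpose (f (- t - 1)) :: real ^ 'd ^ 'd) norm_summable_on UNIV"
  using abs_summable_bounded_linear[OF linear_transpose[unfolded linear_conv_bounded_linear]
      abs_summable_int_reflect[OF assms, of "-1"]]
  by (simp add: minus_diff_commute)

lemma Rhat_D: "Rhat_D P R norm_summable_on UNIV"
  unfolding Rhat_D_def
  by (rule abs_summable_add abs_summable_int_shift abs_summable_transpose_reflect
      Rhat_Bzeta Rhat_Delta Rhat_Bzeta_Delta Rhat_Vzeta2_Delta)+

end

section \<open>Fourier transforms of matrix sequences\<close>

lemma norm_mscale: "norm (c *\<^sub>C A) = norm c * norm A"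
  unfolding norm_vec_def mscale_def by (simp add: norm_mult L2_set_right_distrib)

lemma norm_cmat: "norm (cmat A) = norm A"
  unfolding norm_vec_def cmat_def by simp

lemma norm_cvec: "norm (cvec v) = norm v"
  unfolding norm_vec_def cvec_def by simp

lemma norm_vector_scalar_mult: "norm (c *s v) = norm c * norm v" for v :: "complex ^ 'n"
  unfolding norm_vec_def by (simp add: norm_mult L2_set_right_distrib)

lemma bounded_linear_mscale: "bounded_linear (mscale c)"
  unfolding linear_conv_bounded_linear[symmetric]
  by (rule linearI) (simp_all add: mscale_def vec_eq_iff algebra_simps)

lemma bounded_linear_cmat: "bounded_linear cmat"
  unfolding linear_conv_bounded_linear[symmetric]
  by (rule linearI) (simp_all add: cmat_def vec_eq_iff complex_eq_iff)

lemma bounded_linear_cvec: "bounded_linear cvec"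
  unfolding linear_conv_bounded_linear[symmetric]
  by (rule linearI) (simp_all add: cvec_def vec_eq_iff complex_eq_iff)

lemma bounded_linear_vector_scalar_mult: "bounded_linear ((*s) c)" for c :: complex
  unfolding linear_conv_bounded_linear[symmetric]
  by (rule linearI) (simp_all add: vec_eq_iff algebra_simps)

lemma bounded_linear_conj_transpose: "bounded_linear conj_transpose"
  unfolding linear_conv_bounded_linear[symmetric]
  by (rule linearI) (simp_all add: conj_transpose_def vec_eq_iff)

lemma cmat_mult: "cmat (A ** B) = cmat A ** cmat B"
  by (simp add: cmat_def matrix_matrix_mult_def vec_eq_iff)

lemma cmat_transpose: "cmat (transpose A) = transpose (cmat A)"
  by (simp add: cmat_def transpose_def vec_eq_iff)

lemma cmat_mat_1: "cmat (mat 1) = mat 1"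
  by (simp add: cmat_def mat_def vec_eq_iff)

lemma cmat_mpow: "cmat (mpow A n) = mpow (cmat A) n"
  by (induction n) (simp_all add: cmat_mult cmat_mat_1)

lemma cvec_matrix_vector_mult: "cvec (A *v x) = cmat A *v cvec x"
  by (simp add: cvec_def cmat_def matrix_vector_mult_def vec_eq_iff)

lemma mscale_matrix_mult_left: "(c *\<^sub>C A) ** B = c *\<^sub>C (A ** B)"
  by (simp add: mscale_def matrix_matrix_mult_def vec_eq_iff sum_distrib_left mult.assoc)

lemma mscale_matrix_mult_right: "A ** (c *\<^sub>C B) = c *\<^sub>C (A ** B)"
  by (simp add: mscale_def matrix_matrix_mult_def vec_eq_iff sum_distrib_left mult_ac)

lemma mscale_mscale: "a *\<^sub>C b *\<^sub>C A = (a * b) *\<^sub>C A"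
  by (simp add: mscale_def vec_eq_iff mult.assoc)

lemma mscale_add: "c *\<^sub>C (A + B) = c *\<^sub>C A + c *\<^sub>C B"
  by (simp add: mscale_def vec_eq_iff algebra_simps)

lemma mscale_1: "1 *\<^sub>C A = A"
  by (simp add: mscale_def vec_eq_iff)

lemma mpow_mscale: "mpow (c *\<^sub>C A) n = c ^ n *\<^sub>C mpow A n"
  by (induction n)
    (simp_all add: mscale_1 mscale_matrix_mult_left mscale_matrix_mult_right mscale_mscale mult.commute)

text \<open>Naming the kernel exposes a unimodular homomorphism on the integers: delays split off as
  factors, and absolute convergence of a transform is that of the sequence.\<close>

definition character :: "real \<Rightarrow> int \<Rightarrow> complex" where
  "character \<theta> t = exp (- (\<i> * complex_of_real \<theta> * of_int t))"

lemma norm_character: "norm (character \<theta> t) = 1"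
  by (simp add: character_def)

lemma character_add: "character \<theta> (s + t) = character \<theta> s * character \<theta> t"
  by (simp add: character_def exp_add[symmetric] algebra_simps)

lemma character_nat: "character \<theta> (int n) = exp (- (\<i> * complex_of_real \<theta>)) ^ n"
  by (simp add: character_def exp_of_nat_mult[symmetric] mult_ac)

lemma character_minus_nat: "character \<theta> (- int n) = exp (\<i> * complex_of_real \<theta>) ^ n"
  by (simp add: character_def exp_of_nat_mult[symmetric] mult_ac)

lemma cnj_character: "cnj (character \<theta> t) = character \<theta> (- t)"
  by (simp add: character_def exp_cnj)

lemma fourier_eq: "fourier f \<theta> = (\<Sum>\<^sub>\<infinity>t. character \<theta> t *\<^sub>C cmat (f t))"
  by (simp add: fourier_def character_def)

lemma abs_summable_fourier:
  assumes "f norm_summable_on UNIV"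
  shows "(\<lambda>t. character \<theta> t *\<^sub>C cmat (f t)) norm_summable_on UNIV"
  using assms by (simp add: norm_mscale norm_character norm_cmat)

lemmas summable_fourier = abs_summable_summable[OF abs_summable_fourier]

lemma fourier_add:
  assumes "f norm_summable_on UNIV" "g norm_summable_on UNIV"
  shows "fourier (\<lambda>t. f t + g t) \<theta> = fourier f \<theta> + fourier g \<theta>"
  unfolding fourier_eq linear_add[OF bounded_linear.linear[OF bounded_linear_cmat]] mscale_add
  by (rule infsum_add[OF summable_fourier summable_fourier]) (rule assms)+

lemma fourier_shift:
  assumes "f norm_summable_on UNIV"
  shows "fourier (\<lambda>t. f (t - 1)) \<theta> = exp (- (\<i> * complex_of_real \<theta>)) *\<^sub>C fourier f \<theta>"
proof -
  have "bij_betw (\<lambda>t. t - 1) UNIV (UNIV :: int set)"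
    by (rule bij_betwI[where g = "\<lambda>t. t + 1"]) auto
  then have "(\<Sum>\<^sub>\<infinity>t. character \<theta> (t - 1 + 1) *\<^sub>C cmat (f (t - 1)))
      = (\<Sum>\<^sub>\<infinity>t. character \<theta> (t + 1) *\<^sub>C cmat (f t))"
    by (rule infsum_reindex_bij_betw)
  then have "fourier (\<lambda>t. f (t - 1)) \<theta> = (\<Sum>\<^sub>\<infinity>t. character \<theta> 1 *\<^sub>C character \<theta> t *\<^sub>C cmat (f t))"
    by (simp add: fourier_eq character_add[of _ _ 1] mscale_mscale mult.commute)
  also have "\<dots> = character \<theta> 1 *\<^sub>C fourier f \<theta>"
    unfolding fourier_eq
    by (rule infsum_bounded_linear[OF bounded_linear_mscale summable_fourier[OF assms]])
  finally show ?thesis by (simp add: character_def)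
qed

text \<open>Under the involution \<open>t \<mapsto> - t - 1\<close>, time reversal becomes
  conjugation of the kernel because \<open>f\<close> is real; the offset 1 leaves the exponential
  factor inside the adjoint.\<close>

lemma fourier_adjoint:
  assumes "f norm_summable_on UNIV"
  shows "fourier (\<lambda>t. transpose (f (- t - 1))) \<theta>
    = conj_transpose (exp (- (\<i> * complex_of_real \<theta>)) *\<^sub>C fourier f \<theta>)"
proof -
  let ?h = "\<lambda>t. conj_transpose (character \<theta> (t + 1) *\<^sub>C cmat (f t))"
  have bij: "bij_betw (\<lambda>t. - t - 1) UNIV (UNIV :: int set)"
    by (rule bij_betwI[where g = "\<lambda>t. - t - 1"]) auto
  have "character \<theta> t *\<^sub>C cmat (transpose (f (- t - 1))) = ?h (- t - 1)" for t
    by (simp add: vec_eq_iff conj_transpose_def mscale_def cmat_def transpose_def cnj_character)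
  then have "fourier (\<lambda>t. transpose (f (- t - 1))) \<theta> = (\<Sum>\<^sub>\<infinity>t. ?h t)"
    unfolding fourier_eq using infsum_reindex_bij_betw[OF bij, of ?h] by simp
  also have "\<dots> = (\<Sum>\<^sub>\<infinity>t. conj_transpose (character \<theta> 1 *\<^sub>C (character \<theta> t *\<^sub>C cmat (f t))))"
    by (simp add: character_add mscale_mscale mult.commute)
  also have "\<dots> = conj_transpose (character \<theta> 1 *\<^sub>C fourier f \<theta>)"
    unfolding fourier_eq
    by (rule infsum_bounded_linear[OF bounded_linear_compose[OF bounded_linear_conj_transpose
            bounded_linear_mscale] summable_fourier[OF assms]])
  finally show ?thesis by (simp add: character_def)
qed

section \<open>Two-sided matrix filters and their transforms\<close>

lemma norm_sandwich:
  obtains K where "0 \<le> K"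
    "\<And>(A :: ('a::{euclidean_space,real_normed_field}) ^ 'd ^ 'd) (Z :: 'a ^ 'd ^ 'd) (B :: 'a ^ 'd ^ 'd).
      norm (A ** Z ** B) \<le> norm A * norm B * K * norm Z"
proof -
  obtain K where K: "\<And>(A :: 'a ^ 'd ^ 'd) (B :: 'a ^ 'd ^ 'd). norm (A ** B) \<le> norm A * norm B * K" "0 < K"
    using bounded_bilinear.pos_bounded[OF bounded_bilinear_matrix_mult] by blast
  have "norm (A ** Z ** B) \<le> norm A * norm B * (K * K) * norm Z" for A Z B :: "'a ^ 'd ^ 'd"
  proof -
    have "norm (A ** Z ** B) \<le> norm (A ** Z) * norm B * K" by (rule K)
    also have "\<dots> \<le> (norm A * norm Z * K) * norm B * K"
      using K by (intro mult_right_mono) auto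
    finally show ?thesis by (simp add: mult_ac)
  qed
  then show ?thesis using that[of "K * K"] by simp
qed

context
  fixes G :: "int \<Rightarrow> real ^ 'd ^ 'd" and M N :: "'i \<Rightarrow> real ^ 'd ^ 'd" and s :: "'i \<Rightarrow> int"
  assumes G: "G norm_summable_on UNIV" and MN: "(\<lambda>i. norm (M i) * norm (N i)) summable_on UNIV"
begin

lemma sandwich_convolution:
  "(\<lambda>i. M i ** G (t - s i) ** N i) summable_on UNIV"
  "(\<lambda>t. \<Sum>\<^sub>\<infinity>i. M i ** G (t - s i) ** N i) norm_summable_on UNIV"
proof -
  obtain K where K: "0 \<le> K"
    "\<And>(A :: real ^ 'd ^ 'd) (Z :: real ^ 'd ^ 'd) (B :: real ^ 'd ^ 'd). norm (A ** Z ** B) \<le> norm A * norm B * K * norm Z"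
    by (rule norm_sandwich) blast
  have bl: "bounded_linear (\<lambda>Z. M i ** Z ** N i)" for i
    by (rule bounded_linear_compose[OF bounded_linear_matrix_mult_left bounded_linear_matrix_mult_right])
  have c: "(\<lambda>i. norm (M i) * norm (N i) * K) summable_on UNIV"
    using MN by (rule summable_on_cmult_left)
  have le: "norm (M i ** Z ** N i) \<le> norm (M i) * norm (N i) * K * norm Z" for i Z
    by (rule K(2))
  show "(\<lambda>i. M i ** G (t - s i) ** N i) summable_on UNIV"
    by (rule convolution_summable_inner[OF G bl le _ c]) (simp add: K(1))
  show "(\<lambda>t. \<Sum>\<^sub>\<infinity>i. M i ** G (t - s i) ** N i) norm_summable_on UNIV"
    by (rule convolution_abs_summable[OF G bl le _ c]) (simp add: K(1))
qed

text \<open>The kernel at \<open>t\<close> is the product of those at \<open>s i\<close> and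
  \<open>t - s i\<close>. The first joins the operator, the second the filtered sequence, whose sum
  over \<open>t\<close> is \<open>fourier G\<close>.\<close>

lemma fourier_sandwich_convolution:
  "fourier (\<lambda>t. \<Sum>\<^sub>\<infinity>i. M i ** G (t - s i) ** N i) \<theta>
    = (\<Sum>\<^sub>\<infinity>i. character \<theta> (s i) *\<^sub>C (cmat (M i) ** fourier G \<theta> ** cmat (N i)))"
proof -
  obtain K where K: "0 \<le> K"
    "\<And>(A :: complex ^ 'd ^ 'd) (Z :: complex ^ 'd ^ 'd) (B :: complex ^ 'd ^ 'd). norm (A ** Z ** B) \<le> norm A * norm B * K * norm Z"
    by (rule norm_sandwich) blast
  define H where "H t = character \<theta> t *\<^sub>C cmat (G t)" for t
  define L where "L i Z = character \<theta> (s i) *\<^sub>C (cmat (M i) ** Z ** cmat (N i))" for i Z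
  have bl: "bounded_linear (L i)" for i
    unfolding L_def
    by (rule bounded_linear_compose[OF bounded_linear_mscale bounded_linear_compose[OF
          bounded_linear_matrix_mult_left bounded_linear_matrix_mult_right]])
  have L_le: "norm (L i Z) \<le> norm (M i) * norm (N i) * K * norm Z" for i Z
    using K(2)[of "cmat (M i)" Z "cmat (N i)"]
    by (simp add: L_def norm_mscale norm_character norm_cmat)
  have c: "(\<lambda>i. norm (M i) * norm (N i) * K) summable_on UNIV"
    using MN by (rule summable_on_cmult_left)
  have H: "H norm_summable_on UNIV" unfolding H_def by (rule abs_summable_fourier[OF G])
  have "character \<theta> t *\<^sub>C cmat (\<Sum>\<^sub>\<infinity>i. M i ** G (t - s i) ** N i) = (\<Sum>\<^sub>\<infinity>i. L i (H (t - s i)))" for t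
  proof -
    have "L i (H (t - s i)) = character \<theta> t *\<^sub>C cmat (M i ** G (t - s i) ** N i)" for i
      using character_add[of \<theta> "s i" "t - s i"]
      by (simp add: L_def H_def cmat_mult mscale_matrix_mult_left mscale_matrix_mult_right mscale_mscale)
    then show ?thesis
      using infsum_bounded_linear[OF bounded_linear_compose[OF bounded_linear_mscale
              bounded_linear_cmat] sandwich_convolution(1)] by simp
  qed
  then have "fourier (\<lambda>t. \<Sum>\<^sub>\<infinity>i. M i ** G (t - s i) ** N i) \<theta> = (\<Sum>\<^sub>\<infinity>t. \<Sum>\<^sub>\<infinity>i. L i (H (t - s i)))"
    by (simp add: fourier_eq)
  also have "\<dots> = (\<Sum>\<^sub>\<infinity>i. L i (\<Sum>\<^sub>\<infinity>t. H t))"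
    by (rule infsum_convolution[OF H bl L_le _ c]) (simp add: K(1))
  finally show ?thesis by (simp add: L_def H_def fourier_eq)
qed

end

lemma abs_summable_prod:
  fixes f :: "'i \<Rightarrow> 'a::real_normed_vector" and g :: "'j \<Rightarrow> 'b::real_normed_vector"
  assumes "f norm_summable_on UNIV" "g norm_summable_on UNIV"
  shows "(\<lambda>p. norm (f (fst p)) * norm (g (snd p))) summable_on UNIV"
proof -
  have "(\<lambda>(i, k). norm (f i) * norm (g k)) norm_summable_on UNIV \<times> UNIV"
    unfolding Infinite_Sum.abs_summable_on_Sigma_iff
    using assms by (auto simp: abs_mult infsum_nonneg infsum_cmult_right
        intro!: summable_on_cmult_right summable_on_cmult_left)
  then show ?thesis by (simp add: case_prod_unfold abs_mult)
qed

text \<open>Absolute convergence over pairs allows summing one index at a time, and each single sum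
  passes through a bounded linear map.\<close>

lemma infsum_sandwich:
  fixes f :: "'i \<Rightarrow> complex ^ 'd ^ 'd" and g :: "'j \<Rightarrow> complex ^ 'd ^ 'd"
  assumes f: "f norm_summable_on UNIV" and g: "g norm_summable_on UNIV"
  shows "(\<Sum>\<^sub>\<infinity>p. f (fst p) ** S ** g (snd p)) = (\<Sum>\<^sub>\<infinity>i. f i) ** S ** (\<Sum>\<^sub>\<infinity>k. g k)"
proof -
  obtain K where K: "0 \<le> K"
    "\<And>(A :: complex ^ 'd ^ 'd) (Z :: complex ^ 'd ^ 'd) (B :: complex ^ 'd ^ 'd). norm (A ** Z ** B) \<le> norm A * norm B * K * norm Z"
    by (rule norm_sandwich) blast
  have "(\<lambda>p. f (fst p) ** S ** g (snd p)) norm_summable_on UNIV"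
  proof (rule Infinite_Sum.abs_summable_on_comparison_test)
    show "(\<lambda>p. norm (f (fst p)) * norm (g (snd p)) * (K * norm S)) norm_summable_on UNIV"
      using summable_on_cmult_left[OF abs_summable_prod[OF f g], of "K * norm S"] K(1)
      by (simp add: abs_mult)
    show "norm (f (fst p) ** S ** g (snd p)) \<le> norm (norm (f (fst p)) * norm (g (snd p)) * (K * norm S))" for p
      using K(2)[of "f (fst p)" S "g (snd p)"] K(1) by (simp add: abs_mult mult.assoc)
  qed
  then have "(\<Sum>\<^sub>\<infinity>p. f (fst p) ** S ** g (snd p)) = (\<Sum>\<^sub>\<infinity>i. \<Sum>\<^sub>\<infinity>k. f i ** S ** g k)"
    using infsum_Sigma_banach[of "\<lambda>p. f (fst p) ** S ** g (snd p)" UNIV "\<lambda>_. UNIV"]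
    by (simp add: abs_summable_summable)
  also have "\<dots> = (\<Sum>\<^sub>\<infinity>i. f i ** S ** (\<Sum>\<^sub>\<infinity>k. g k))"
    by (rule infsum_cong, rule infsum_bounded_linear[OF bounded_linear_matrix_mult_right abs_summable_summable[OF g]])
  also have "\<dots> = (\<Sum>\<^sub>\<infinity>i. f i) ** S ** (\<Sum>\<^sub>\<infinity>k. g k)"
    by (rule infsum_bounded_linear[OF bounded_linear_compose[OF bounded_linear_matrix_mult_left
            bounded_linear_matrix_mult_left] abs_summable_summable[OF f]])
  finally show ?thesis .
qed

section \<open>Spectra\<close>

context linearized_chain
begin

lemma Rhat_D_summable_sandwich:
  shows "(\<lambda>(i, k). mpow (Atilde P) i ** Rhat_D P R (t - int i + int k) ** transpose (mpow (Atilde P) k))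
      summable_on UNIV \<times> UNIV"
    and Sigma_hat_Gamma: "Sigma_hat_Gamma P R norm_summable_on UNIV"
    and "Shat_Gamma P R \<theta> = (\<Sum>\<^sub>\<infinity>p. character \<theta> (int (fst p) - int (snd p)) *\<^sub>C
      (cmat (mpow (Atilde P) (fst p)) ** Shat_D P R \<theta> ** cmat (transpose (mpow (Atilde P) (snd p)))))"
proof -
  have KT: "(\<lambda>k. transpose (mpow (Atilde P) k)) norm_summable_on UNIV"
    by (rule abs_summable_bounded_linear[OF linear_transpose[unfolded linear_conv_bounded_linear] Atilde])
  note conv = sandwich_convolution[OF Rhat_D abs_summable_prod[OF Atilde KT]]
    and four = fourier_sandwich_convolution[OF Rhat_D abs_summable_prod[OF Atilde KT]]
  \<comment> \<open>Both filters act at once: the index is the pair \<open>(i, k)\<close> and the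
    delay is \<open>int i - int k\<close>.\<close>
  have eq: "t - int i + int k = t - (int i - int k)" for t i k by simp
  show "(\<lambda>(i, k). mpow (Atilde P) i ** Rhat_D P R (t - int i + int k) ** transpose (mpow (Atilde P) k))
      summable_on UNIV \<times> UNIV"
    using conv(1)[of t "\<lambda>p. int (fst p) - int (snd p)"] by (simp add: eq case_prod_unfold)
  show "Sigma_hat_Gamma P R norm_summable_on UNIV"
    using conv(2)[of "\<lambda>p. int (fst p) - int (snd p)"]
    by (simp add: eq case_prod_unfold Sigma_hat_Gamma_def)
  show "Shat_Gamma P R \<theta> = (\<Sum>\<^sub>\<infinity>p. character \<theta> (int (fst p) - int (snd p)) *\<^sub>C
      (cmat (mpow (Atilde P) (fst p)) ** Shat_D P R \<theta> ** cmat (transpose (mpow (Atilde P) (snd p)))))"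
    unfolding Shat_Gamma_def Shat_D_def four[symmetric]
    by (rule fun_cong[OF arg_cong[where f = fourier]])
      (simp add: fun_eq_iff eq case_prod_unfold Sigma_hat_Gamma_def)
qed

lemma Rhat_D_summable_left:
  shows "(\<lambda>i. mpow (Atilde P) i ** Rhat_D P R (t - int i)) summable_on UNIV"
    and Sigma_hat_Gamma_D: "Sigma_hat_Gamma_D P R norm_summable_on UNIV"
    and "Shat_Gamma_D P R \<theta> = (\<Sum>\<^sub>\<infinity>i. character \<theta> (int i) *\<^sub>C
      (cmat (mpow (Atilde P) i) ** Shat_D P R \<theta>))"
proof -
  \<comment> \<open>A one-sided filter is a sandwich with the identity on the right.\<close>
  have MN: "(\<lambda>i. norm (mpow (Atilde P) i) * norm (mat 1 :: real ^ 'd ^ 'd)) summable_on UNIV"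
    by (rule summable_on_cmult_left[OF Atilde])
  note conv = sandwich_convolution[OF Rhat_D MN] and four = fourier_sandwich_convolution[OF Rhat_D MN]
  show "(\<lambda>i. mpow (Atilde P) i ** Rhat_D P R (t - int i)) summable_on UNIV"
    using conv(1)[of t int] by simp
  show "Sigma_hat_Gamma_D P R norm_summable_on UNIV"
    using conv(2)[of int] by (simp add: Sigma_hat_Gamma_D_def)
  show "Shat_Gamma_D P R \<theta> = (\<Sum>\<^sub>\<infinity>i. character \<theta> (int i) *\<^sub>C
      (cmat (mpow (Atilde P) i) ** Shat_D P R \<theta>))"
  proof -
    have "Sigma_hat_Gamma_D P R = (\<lambda>t. \<Sum>\<^sub>\<infinity>i. mpow (Atilde P) i ** Rhat_D P R (t - int i) ** mat 1)"
      by (simp add: fun_eq_iff Sigma_hat_Gamma_D_def)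
    then show ?thesis unfolding Shat_Gamma_D_def Shat_D_def using four[of int \<theta>]
      by (simp add: cmat_mat_1)
  qed
qed

lemma Shat_D_eq:
  "Shat_D P R \<theta> =
       Shat_Delta P R \<theta> + Shat_Bzeta P R \<theta>
       + exp (- (\<i> * complex_of_real \<theta>)) *\<^sub>C Shat_Bzeta_Delta P R \<theta>
       + conj_transpose (exp (- (\<i> * complex_of_real \<theta>)) *\<^sub>C Shat_Bzeta_Delta P R \<theta>)
       + exp (- (\<i> * complex_of_real \<theta>)) *\<^sub>C Shat_Vzeta2_Delta P R \<theta>
       + conj_transpose (exp (- (\<i> * complex_of_real \<theta>)) *\<^sub>C Shat_Vzeta2_Delta P R \<theta>)"
proof -
  note f1 = abs_summable_int_shift[OF Rhat_Bzeta_Delta, of 1]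
    and f2 = abs_summable_transpose_reflect[OF Rhat_Bzeta_Delta]
    and f3 = abs_summable_int_shift[OF Rhat_Vzeta2_Delta, of 1]
    and f4 = abs_summable_transpose_reflect[OF Rhat_Vzeta2_Delta]
  note s0 = abs_summable_add[OF Rhat_Bzeta Rhat_Delta]
  note s1 = abs_summable_add[OF s0 f1]
  note s2 = abs_summable_add[OF s1 f2]
  note s3 = abs_summable_add[OF s2 f3]
  have "Rhat_D P R = (\<lambda>t. Rhat_Bzeta P R t + Rhat_Delta P R t
     + Rhat_Bzeta_Delta P R (t - 1) + transpose (Rhat_Bzeta_Delta P R (- t - 1))
     + Rhat_Vzeta2_Delta P R (t - 1) + transpose (Rhat_Vzeta2_Delta P R (- t - 1)))"
    by (simp add: fun_eq_iff Rhat_D_def)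
  then have "Shat_D P R \<theta> = fourier (Rhat_Bzeta P R) \<theta> + fourier (Rhat_Delta P R) \<theta>
      + fourier (\<lambda>t. Rhat_Bzeta_Delta P R (t - 1)) \<theta>
      + fourier (\<lambda>t. transpose (Rhat_Bzeta_Delta P R (- t - 1))) \<theta>
      + fourier (\<lambda>t. Rhat_Vzeta2_Delta P R (t - 1)) \<theta>
      + fourier (\<lambda>t. transpose (Rhat_Vzeta2_Delta P R (- t - 1))) \<theta>"
    by (simp only: Shat_D_def fourier_add[OF s3 f4] fourier_add[OF s2 f3] fourier_add[OF s1 f2]
        fourier_add[OF s0 f1] fourier_add[OF Rhat_Bzeta Rhat_Delta])
  then show ?thesis
    by (simp only: fourier_shift[OF Rhat_Bzeta_Delta] fourier_shift[OF Rhat_Vzeta2_Delta]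
        fourier_adjoint[OF Rhat_Bzeta_Delta] fourier_adjoint[OF Rhat_Vzeta2_Delta]
        Shat_Delta_def Shat_Bzeta_def Shat_Bzeta_Delta_def Shat_Vzeta2_Delta_def)
      (simp only: add.commute[of "fourier (Rhat_Bzeta P R) \<theta>"])
qed

text \<open>A scalar of modulus 1 does not change the norm of any power, so the Neumann series
  converges on the whole unit circle, that is, at every frequency.\<close>

lemma abs_summable_mpow_mscale:
  assumes "norm z = 1"
  shows "mpow (z *\<^sub>C cmat (Atilde P)) norm_summable_on UNIV"
  using Atilde assms by (simp add: mpow_mscale norm_mscale norm_power cmat_mpow[symmetric] norm_cmat)

lemma abs_summable_mpow_mscale_transpose:
  assumes "norm z = 1"
  shows "mpow (z *\<^sub>C transpose (cmat (Atilde P))) norm_summable_on UNIV"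
proof -
  have "(\<lambda>k. transpose (mpow (Atilde P) k)) norm_summable_on UNIV"
    by (rule abs_summable_bounded_linear[OF linear_transpose[unfolded linear_conv_bounded_linear] Atilde])
  then show ?thesis using assms
    by (simp add: mpow_mscale norm_mscale norm_power mpow_transpose cmat_mpow[symmetric]
        cmat_transpose[symmetric] norm_cmat)
qed

lemma invertible_transfer:
  "norm z = 1 \<Longrightarrow> invertible (mat 1 - z *\<^sub>C cmat (Atilde P))"
  "norm z = 1 \<Longrightarrow> invertible (mat 1 - z *\<^sub>C transpose (cmat (Atilde P)))"
  by (rule neumann_series(1)[OF abs_summable_mpow_mscale],
      assumption, rule neumann_series(1)[OF abs_summable_mpow_mscale_transpose])

text \<open>The kernel at \<open>int i - int k\<close> factors as \<open>?z ^ i * ?w ^ k\<close>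
  with \<open>?w\<close> the conjugate of \<open>?z\<close>, so the double series splits into one
  Neumann series on each side of \<open>Shat_D\<close>.\<close>

lemma Shat_Gamma_eq:
  "Shat_Gamma P R \<theta> =
     matrix_inv (mat 1 - exp (- (\<i> * complex_of_real \<theta>)) *\<^sub>C cmat (Atilde P))
     ** Shat_D P R \<theta>
     ** matrix_inv (mat 1 - exp (\<i> * complex_of_real \<theta>) *\<^sub>C transpose (cmat (Atilde P)))"
proof -
  let ?z = "exp (- (\<i> * complex_of_real \<theta>))" and ?w = "exp (\<i> * complex_of_real \<theta>)"
  have z: "norm ?z = 1" and w: "norm ?w = 1" by simp_all
  have "character \<theta> (int i - int k) = ?z ^ i * ?w ^ k" for i k
    using character_add[of \<theta> "int i" "- int k"] by (simp add: character_nat character_minus_nat)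
  then have "Shat_Gamma P R \<theta> = (\<Sum>\<^sub>\<infinity>p. mpow (?z *\<^sub>C cmat (Atilde P)) (fst p)
      ** Shat_D P R \<theta> ** mpow (?w *\<^sub>C transpose (cmat (Atilde P))) (snd p))"
    unfolding Rhat_D_summable_sandwich(3)
    by (simp add: mpow_mscale mpow_transpose cmat_mpow cmat_transpose mscale_matrix_mult_left
        mscale_matrix_mult_right mscale_mscale mult.commute)
  then show ?thesis
    by (simp only: infsum_sandwich[OF abs_summable_mpow_mscale[OF z] abs_summable_mpow_mscale_transpose[OF w]]
        neumann_series(2)[OF abs_summable_mpow_mscale[OF z]]
        neumann_series(2)[OF abs_summable_mpow_mscale_transpose[OF w]])
qed

lemma Shat_Gamma_D_eq:
  "Shat_Gamma_D P R \<theta> =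
     matrix_inv (mat 1 - exp (- (\<i> * complex_of_real \<theta>)) *\<^sub>C cmat (Atilde P)) ** Shat_D P R \<theta>"
proof -
  let ?z = "exp (- (\<i> * complex_of_real \<theta>))"
  have z: "norm ?z = 1" by simp
  have "Shat_Gamma_D P R \<theta> = (\<Sum>\<^sub>\<infinity>i. mpow (?z *\<^sub>C cmat (Atilde P)) i ** Shat_D P R \<theta>)"
    unfolding Rhat_D_summable_left(3)
    by (simp add: character_nat mpow_mscale cmat_mpow mscale_matrix_mult_left)
  also have "\<dots> = (\<Sum>\<^sub>\<infinity>i. mpow (?z *\<^sub>C cmat (Atilde P)) i) ** Shat_D P R \<theta>"
    by (rule infsum_bounded_linear[OF bounded_linear_matrix_mult_left
          abs_summable_summable[OF abs_summable_mpow_mscale[OF z]]])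
  finally show ?thesis by (simp only: neumann_series(2)[OF abs_summable_mpow_mscale[OF z]])
qed

text \<open>This makes \<open>U1\<close> a genuine inverse, the fundamental matrix of the chain:
  after transposing back, it is the Neumann series of \<open>P 0 - ones_pi0 P\<close>.\<close>

lemma invertible_fundamental: "invertible (mat 1 - P 0 + ones_pi0 P)"
proof -
  have "(\<lambda>n. transpose (mpow (Atilde P) n)) norm_summable_on UNIV"
    by (rule abs_summable_bounded_linear[OF linear_transpose[unfolded linear_conv_bounded_linear] Atilde])
  then have "mpow (P 0 - ones_pi0 P) norm_summable_on UNIV" by (simp add: mpow_Atilde)
  from neumann_series(1)[OF this] show ?thesis by (simp add: algebra_simps)
qed

lemma Sigma_hat_Gamma_zeta_summable:
  assumes R1: "R1 norm_summable_on UNIV"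
  shows "(\<lambda>i. R1 (t - int i) *\<^sub>R (mpow (Atilde P) (i - 1) *v BB P)) summable_on {1..}"
    and "Sigma_hat_Gamma_zeta P \<epsilon> R1 norm_summable_on UNIV"
proof -
  let ?v = "\<lambda>n. mpow (Atilde P) n *v BB P"
  have le: "norm (r *\<^sub>R ?v n) \<le> norm (?v n) * norm r" for n r by simp
  have inner: "(\<lambda>n. R1 (t - (int n + 1)) *\<^sub>R ?v n) summable_on UNIV" for t
    by (rule convolution_summable_inner[OF R1 bounded_linear_scaleR_left le norm_ge_zero abs_summable_mpow_BB])
  then show "(\<lambda>i. R1 (t - int i) *\<^sub>R ?v (i - 1)) summable_on {1..}"
    unfolding summable_on_from_1 by (simp add: add.commute)
  have "(\<lambda>t. \<Sum>\<^sub>\<infinity>n. R1 (t - (int n + 1)) *\<^sub>R ?v n) norm_summable_on UNIV"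
    by (rule convolution_abs_summable[OF R1 bounded_linear_scaleR_left le norm_ge_zero abs_summable_mpow_BB])
  from abs_summable_bounded_linear[OF bounded_linear_scaleR_right[of "\<epsilon>\<^sup>2"] this]
  show "Sigma_hat_Gamma_zeta P \<epsilon> R1 norm_summable_on UNIV"
    unfolding Sigma_hat_Gamma_zeta_def infsum_from_1 by (simp add: add.commute)
qed

text \<open>Moving the kernel and \<open>\<epsilon>\<^sup>2\<close> across infinite sums rests on
  convergence, first of the sum over \<open>i\<close>, then of the sum over
  \<open>t\<close>.\<close>

lemma Shat_Gamma_zeta_eq:
  assumes R1: "R1 norm_summable_on UNIV" and \<epsilon>: "\<epsilon> \<noteq> 0"
  shows "Shat_Gamma_zeta P \<epsilon> R1 \<theta> =
       complex_of_real (\<epsilon>^2) *s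
         (\<Sum>\<^sub>\<infinity>t\<in>UNIV. \<Sum>\<^sub>\<infinity>i\<in>{1..}.
            (complex_of_real (R1 (t - int i)) * exp (- (\<i> * complex_of_real \<theta> * of_int t)))
              *s (mpow (cmat (Atilde P)) (i - 1) *v cvec (BB P)))"
proof -
  define S where "S t = (\<Sum>\<^sub>\<infinity>i\<in>{1..}. R1 (t - int i) *\<^sub>R (mpow (Atilde P) (i - 1) *v BB P))" for t
  have inner: "(\<Sum>\<^sub>\<infinity>i\<in>{1..}.
            (complex_of_real (R1 (t - int i)) * exp (- (\<i> * complex_of_real \<theta> * of_int t)))
              *s (mpow (cmat (Atilde P)) (i - 1) *v cvec (BB P)))
      = character \<theta> t *s cvec (S t)" for t
  proof -
    have "(complex_of_real r * character \<theta> t) *s (mpow (cmat (Atilde P)) n *v cvec (BB P))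
        = character \<theta> t *s cvec (r *\<^sub>R (mpow (Atilde P) n *v BB P))" for r n
      by (simp add: cmat_mpow[symmetric] cvec_matrix_vector_mult[symmetric])
        (simp add: cvec_def vec_eq_iff)
    then show ?thesis
      unfolding S_def character_def[symmetric]
      using infsum_bounded_linear[OF bounded_linear_compose[OF bounded_linear_vector_scalar_mult
            bounded_linear_cvec] Sigma_hat_Gamma_zeta_summable(1)[OF R1, of t], of "character \<theta> t"]
      by simp
  qed
  \<comment> \<open>Summability is known with the factor \<open>\<epsilon>\<^sup>2\<close>; dividing
    by it recovers that of \<open>S\<close>.\<close>
  have "(\<lambda>t. inverse (\<epsilon>\<^sup>2) *\<^sub>R Sigma_hat_Gamma_zeta P \<epsilon> R1 t) norm_summable_on UNIV"
    by (rule abs_summable_bounded_linear[OF bounded_linear_scaleR_right Sigma_hat_Gamma_zeta_summable(2)[OF R1]])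
  moreover have "S = (\<lambda>t. inverse (\<epsilon>\<^sup>2) *\<^sub>R Sigma_hat_Gamma_zeta P \<epsilon> R1 t)"
    using \<epsilon> by (simp add: fun_eq_iff Sigma_hat_Gamma_zeta_def S_def)
  ultimately have "S norm_summable_on UNIV" by (simp only:)
  then have "(\<lambda>t. character \<theta> t *s cvec (S t)) norm_summable_on UNIV"
    by (simp add: norm_vector_scalar_mult norm_character norm_cvec)
  then have S: "(\<lambda>t. character \<theta> t *s cvec (S t)) summable_on UNIV"
    by (rule abs_summable_summable)
  have "Shat_Gamma_zeta P \<epsilon> R1 \<theta> = (\<Sum>\<^sub>\<infinity>t. complex_of_real (\<epsilon>\<^sup>2) *s (character \<theta> t *s cvec (S t)))"
    unfolding Shat_Gamma_zeta_def fourier_vec_def Sigma_hat_Gamma_zeta_def S_def[symmetric] character_def[symmetric]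
    by (rule infsum_cong) (simp add: cvec_def vec_eq_iff mult_ac)
  also have "\<dots> = complex_of_real (\<epsilon>\<^sup>2) *s (\<Sum>\<^sub>\<infinity>t. character \<theta> t *s cvec (S t))"
    by (rule infsum_bounded_linear[OF bounded_linear_vector_scalar_mult S])
  finally show ?thesis by (simp only: inner)
qed

end

section \<open>Consequences of the standing assumptions\<close>

lemma EE_row_sum:
  assumes st: "\<forall>z. row_stochastic (P z)" and A1: "assumption_A1 P"
  shows "(\<Sum>j\<in>UNIV. EE P $ i $ j) = 0"
proof -
  from A1 obtain \<delta> where "\<delta> > 0" "\<forall>\<zeta>\<in>ball 0 \<delta>. P differentiable (at \<zeta>)"
    unfolding assumption_A1_def by blast
  then have "(P has_vector_derivative EE P) (at 0)"
    by (simp add: EE_def dP_def vector_derivative_works[symmetric])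
  moreover have "bounded_linear (\<lambda>A. \<Sum>j\<in>UNIV. A $ i $ j :: real)"
    unfolding linear_conv_bounded_linear[symmetric]
    by (rule linearI) (simp_all add: sum.distrib sum_distrib_left)
  ultimately have "((\<lambda>z. \<Sum>j\<in>UNIV. P z $ i $ j) has_vector_derivative (\<Sum>j\<in>UNIV. EE P $ i $ j)) (at 0)"
    by (rule bounded_linear.has_vector_derivative[rotated])
  then have "((\<lambda>z. 1) has_vector_derivative (\<Sum>j\<in>UNIV. EE P $ i $ j)) (at 0)"
    using st by (simp add: row_stochastic_def)
  from vector_derivative_unique_at[OF this has_vector_derivative_const] show ?thesis .
qed

text \<open>Shifting time by \<open>t\<close> carries the product at times \<open>- t\<close> and 0
  to the product at times 0 and \<open>t\<close>. Since the whole trajectory keeps its law, both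
  means are integrals of one functional on path space.\<close>

lemma autocov_even:
  assumes "stationary_process M borel Z"
  shows "autocov M Z (- t) = autocov M Z t"
proof -
  let ?N = "\<Pi>\<^sub>M t\<in>(UNIV :: int set). (borel :: real measure)"
  have Z[measurable]: "\<And>t. Z t \<in> borel_measurable M"
    using assms by (auto simp: stationary_process_def)
  have shift: "distr M ?N (\<lambda>\<omega> s. Z (s + t) \<omega>) = distr M ?N (\<lambda>\<omega> s. Z s \<omega>)"
    using assms by (auto simp: stationary_process_def)
  have m: "(\<lambda>\<omega> s. Z (s + k) \<omega>) \<in> measurable M ?N" for k
    by (rule measurable_PiM_single') (auto simp: space_PiM)
  have f: "(\<lambda>x. x (- t) * x 0) \<in> borel_measurable ?N" by measurable
  have "(\<integral>x. x (- t) * x 0 \<partial>distr M ?N (\<lambda>\<omega> s. Z (s + k) \<omega>)) = (\<integral>\<omega>. Z (- t + k) \<omega> * Z (0 + k) \<omega> \<partial>M)" for k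
    by (rule integral_distr[OF m f])
  from this[of t] this[of 0] show ?thesis
    by (simp add: shift autocov_def mult.commute)
qed

lemma autocov_scale: "autocov M (\<lambda>t \<omega>. c * Z t \<omega>) t = c\<^sup>2 * autocov M Z t"
proof -
  have "(\<lambda>\<omega>. c * Z t \<omega> * (c * Z 0 \<omega>)) = (\<lambda>\<omega>. c\<^sup>2 * (Z t \<omega> * Z 0 \<omega>))"
    by (simp add: fun_eq_iff power2_eq_square mult_ac)
  then show ?thesis unfolding autocov_def by simp
qed

text \<open>A2 controls nonnegative times only. The absolute values are dominated by their
  nonnegative half plus its reflection, which counts time 0 twice.\<close>

lemma abs_summable_even:
  fixes f :: "int \<Rightarrow> real"
  assumes even: "\<And>t. f (- t) = f t" and f: "summable (\<lambda>n. \<bar>f (int n)\<bar>)"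
  shows "f norm_summable_on UNIV"
proof -
  define a where "a t = (if t < 0 then 0 else \<bar>f (int (nat t))\<bar>)" for t
  have "(\<lambda>n. \<bar>f (int n)\<bar>) norm_summable_on UNIV"
    using f by (intro norm_summable_imp_summable_on) simp
  from abs_summable_int_nonneg[OF this] have a: "a norm_summable_on UNIV"
    unfolding a_def .
  have "(\<lambda>t. a t + a (0 - t)) norm_summable_on UNIV"
    by (rule abs_summable_add[OF a abs_summable_int_reflect[OF a]])
  then show ?thesis
    by (rule Infinite_Sum.abs_summable_on_comparison_test) (auto simp: a_def even)
qed

theorem proposition2p7:
  fixes P :: "real \<Rightarrow> real ^ 'd ^ 'd"
    and M :: "'a measure"
    and \<zeta>1 \<zeta> :: "int \<Rightarrow> 'a \<Rightarrow> real"
    and X :: "real \<Rightarrow> int \<Rightarrow> 'a \<Rightarrow> 'd"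
    and \<Gamma> B V \<Delta> D :: "int \<Rightarrow> 'a \<Rightarrow> real ^ 'd"
    and R1 R :: "int \<Rightarrow> real"
    and \<epsilon>0 \<epsilon> \<theta> :: real
  assumes "prob_space M"
    and stochastic: "\<forall>z. row_stochastic (P z)"
    and A1: "assumption_A1 P"
    and A2: "assumption_A2 M \<zeta>1"
    and eps0: "0 < \<epsilon>0"
      "\<forall>e\<in>{0<..\<epsilon>0}. stationary_controlled_process M P (\<lambda>t \<omega>. e * \<zeta>1 t \<omega>) (X e)"
    and eps: "\<epsilon> \<in> {0<..\<epsilon>0}"
    and zeta: "\<zeta> = (\<lambda>t \<omega>. \<epsilon> * \<zeta>1 t \<omega>)"
    and Gamma: "\<Gamma> = (\<lambda>t \<omega>. axis (X \<epsilon> t \<omega>) 1)"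
    and Delta: "\<forall>t \<omega>. \<Gamma> (t + 1) \<omega> = \<Gamma> t \<omega> v* P (\<zeta> t \<omega>) + \<Delta> (t + 1) \<omega>"
    and B: "B = (\<lambda>t \<omega>. \<Gamma> t \<omega> v* EE P)"
    and V: "V = (\<lambda>t \<omega>. (1/2) *\<^sub>R (\<Gamma> t \<omega> v* WW P))"
    and D: "\<forall>t \<omega>. D (t + 1) \<omega> = \<Delta> (t + 1) \<omega> + \<zeta> t \<omega> *\<^sub>R B t \<omega> + (\<zeta> t \<omega>)^2 *\<^sub>R V t \<omega>"
    and R1: "R1 = autocov M \<zeta>1"
    and R: "R = autocov M \<zeta>"
  shows "(\<exists>!p. invariant_prob_vec (P 0) p) \<and>
    (invertible (mat 1 - P 0 + ones_pi0 P)) \<and>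
    (\<forall>t. (\<lambda>i. R (t - int i) *\<^sub>R (BB P v* mpow (P 0) (i - 1))) summable_on {1..}) \<and>
    (Rhat_Delta P R summable_on UNIV) \<and>
    (Rhat_Bzeta P R summable_on UNIV) \<and>
    (Rhat_Bzeta_Delta P R summable_on UNIV) \<and>
    (Rhat_Vzeta2_Delta P R summable_on UNIV) \<and>
    (Rhat_D P R summable_on UNIV) \<and>
    (\<forall>t. (\<lambda>(i, k). mpow (Atilde P) i ** Rhat_D P R (t - int i + int k)
                     ** transpose (mpow (Atilde P) k))
            summable_on (UNIV::nat set) \<times> (UNIV::nat set)) \<and>
    (Sigma_hat_Gamma P R summable_on UNIV) \<and>
    (\<forall>t. (\<lambda>i. mpow (Atilde P) i ** Rhat_D P R (t - int i)) summable_on (UNIV::nat set)) \<and>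
    (Sigma_hat_Gamma_D P R summable_on UNIV) \<and>
    (\<forall>t. (\<lambda>i. R1 (t - int i) *\<^sub>R (mpow (Atilde P) (i - 1) *v BB P)) summable_on {1..}) \<and>
    (Sigma_hat_Gamma_zeta P \<epsilon> R1 summable_on UNIV) \<and>
    (Shat_D P R \<theta> =
       Shat_Delta P R \<theta> + Shat_Bzeta P R \<theta>
       + exp (- (\<i> * complex_of_real \<theta>)) *\<^sub>C Shat_Bzeta_Delta P R \<theta>
       + conj_transpose (exp (- (\<i> * complex_of_real \<theta>)) *\<^sub>C Shat_Bzeta_Delta P R \<theta>)
       + exp (- (\<i> * complex_of_real \<theta>)) *\<^sub>C Shat_Vzeta2_Delta P R \<theta>
       + conj_transpose (exp (- (\<i> * complex_of_real \<theta>)) *\<^sub>C Shat_Vzeta2_Delta P R \<theta>)) \<and>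
    (invertible (mat 1 - exp (- (\<i> * complex_of_real \<theta>)) *\<^sub>C cmat (Atilde P))) \<and>
    (invertible (mat 1 - exp (\<i> * complex_of_real \<theta>) *\<^sub>C transpose (cmat (Atilde P)))) \<and>
    (Shat_Gamma P R \<theta> =
       matrix_inv (mat 1 - exp (- (\<i> * complex_of_real \<theta>)) *\<^sub>C cmat (Atilde P))
       ** Shat_D P R \<theta>
       ** matrix_inv (mat 1 - exp (\<i> * complex_of_real \<theta>) *\<^sub>C transpose (cmat (Atilde P)))) \<and>
    (Shat_Gamma_D P R \<theta> =
       matrix_inv (mat 1 - exp (- (\<i> * complex_of_real \<theta>)) *\<^sub>C cmat (Atilde P))
       ** Shat_D P R \<theta>) \<and>
    (Shat_Gamma_zeta P \<epsilon> R1 \<theta> =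
       complex_of_real (\<epsilon>^2) *s
         (\<Sum>\<^sub>\<infinity>t\<in>UNIV. \<Sum>\<^sub>\<infinity>i\<in>{1..}.
            (complex_of_real (R1 (t - int i)) * exp (- (\<i> * complex_of_real \<theta> * of_int t)))
              *s (mpow (cmat (Atilde P)) (i - 1) *v cvec (BB P))))"
proof -
  have st: "row_stochastic (P 0)" using stochastic by blast
  have irr: "irreducible_matrix (P 0)" "aperiodic_matrix (P 0)"
    using A1 by (simp_all add: assumption_A1_def)
  note ex1 = ex1_invariant_prob_vec[OF st irr]
  \<comment> \<open>\<open>pi0\<close> is a definite description, so its defining property becomes
    available only after unique existence.\<close>
  have inv: "invariant_prob_vec (P 0) (pi0 P)"
    unfolding pi0_def by (rule theI'[OF ex1])
  have "(\<lambda>n. mpow (P 0 - ones_pi0 P) n) norm_summable_on UNIV"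
    using norm_summable_imp_summable_on[of "\<lambda>n. norm (mpow (P 0 - ones_pi0 P) n)"]
      summable_norm_mpow_sub_rank_one[OF st irr inv] by (simp add: ones_pi0_def)
  from abs_summable_bounded_linear[OF linear_transpose[unfolded linear_conv_bounded_linear] this]
  have K: "mpow (Atilde P) norm_summable_on UNIV" by (simp add: Atilde_def mpow_transpose)
  have Z: "stationary_process M borel \<zeta>1" "summable (\<lambda>n. \<bar>autocov M \<zeta>1 (int n)\<bar>)"
    using A2 by (auto simp: assumption_A2_def)
  have R1_even: "R1 (- t) = R1 t" for t using autocov_even[OF Z(1)] by (simp add: R1)
  have R1_summ: "R1 norm_summable_on UNIV"
    using abs_summable_even[of R1, OF R1_even] Z(2) by (simp add: R1)
  \<comment> \<open>This factor carries summability and evenness from \<open>R1\<close> over to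
    \<open>R\<close>.\<close>
  have R_R1: "R t = \<epsilon>\<^sup>2 * R1 t" for t by (simp add: R R1 zeta autocov_scale)
  have "(\<lambda>t. \<epsilon>\<^sup>2 * R1 t) norm_summable_on UNIV"
    by (rule abs_summable_bounded_linear[OF bounded_linear_mult_right R1_summ])
  then have R_summ: "R norm_summable_on UNIV" by (simp add: R_R1)
  interpret linearized_chain P R
    by unfold_locales (use st inv K EE_row_sum[OF stochastic A1] R_summ R1_even R_R1 in auto)
  have "norm (exp (- (\<i> * complex_of_real \<theta>))) = 1" "norm (exp (\<i> * complex_of_real \<theta>)) = 1"
    by simp_all
  moreover have "\<epsilon> \<noteq> 0" using eps by simp
  ultimately show ?thesis
    using ex1 invertible_fundamental Rhat_Gamma_zeta_inner Rhat_D_summable_sandwich(1)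
      Rhat_D_summable_left(1) Sigma_hat_Gamma_zeta_summable(1)[OF R1_summ]
      abs_summable_summable[OF Rhat_Delta] abs_summable_summable[OF Rhat_Bzeta]
      abs_summable_summable[OF Rhat_Bzeta_Delta] abs_summable_summable[OF Rhat_Vzeta2_Delta]
      abs_summable_summable[OF Rhat_D] abs_summable_summable[OF Sigma_hat_Gamma]
      abs_summable_summable[OF Sigma_hat_Gamma_D]
      abs_summable_summable[OF Sigma_hat_Gamma_zeta_summable(2)[OF R1_summ]]
      Shat_D_eq invertible_transfer Shat_Gamma_eq Shat_Gamma_D_eq Shat_Gamma_zeta_eq[OF R1_summ]
    by (intro conjI allI) blast+
qed

end
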